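(* Let $k\ge1$ be a fixed integer and let $B_k(z)$ be the generating function (by size) of Motzkin trees in which all leaves have unary height exactly $k$. Then, with $\alpha=\frac{1}{2^{k+1}}$, $$[z^n]B_k(z)\sim -\,2^{\,n+\alpha}\,\frac{n^{-1-\alpha}}{\Gamma(-\alpha)},\qquad n\to\infty.$$
   Context: A Motzkin tree is a finite plane rooted tree in which every node has 0, 1 or 2 children; nodes with exactly one child are called unary. The size is the total number of nodes. The unary height of a leaf is the number of unary nodes on the path from the root to that leaf. The generating functions satisfy $B_0(z)=\frac{1-\sqrt{1-4z^2}}{2z}$ and $B_k(z)=\frac{1}{2z}\bigl(1-\sqrt{1-4z^2B_{k-1}(z)}\bigr)$ for $k\ge1$. *)

theory Defs
  imports
    "HOL-Analysis.Analysis"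
    "HOL-Library.Landau_Symbols"
    "HOL-Computational_Algebra.Formal_Power_Series"
begin

unbundle asymp_equiv_syntax

datatype motzkin = Leaf | Unary motzkin | Binary motzkin motzkin

primrec nodes :: "motzkin \<Rightarrow> nat" where
  "nodes Leaf = 1"
| "nodes (Unary t) = 1 + nodes t"
| "nodes (Binary l r) = 1 + nodes l + nodes r"

(* One entry per leaf, from left to right: the number of unary nodes on the path
   from the root to that leaf. *)
primrec unary_heights :: "motzkin \<Rightarrow> nat list" where
  "unary_heights Leaf = [0]"
| "unary_heights (Unary t) = map Suc (unary_heights t)"
| "unary_heights (Binary l r) = unary_heights l @ unary_heights r"

definition motzkin_const :: "nat \<Rightarrow> motzkin set" where
  "motzkin_const k = {t. \<forall>h \<in> set (unary_heights t). h = k}"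

definition B :: "nat \<Rightarrow> real fps" where
  "B k = Abs_fps (\<lambda>n. real (card {t \<in> motzkin_const k. nodes t = n}))"

lemma finite_motzkin_nodes_le: "finite {t. nodes t \<le> n}"
proof (induction n)
  case 0
  have "\<not> nodes t \<le> 0" for t
    by (cases t) simp_all
  then have "{t. nodes t \<le> 0} = {}"
    by blast
  then show ?case
    by (metis finite.emptyI)
next
  case (Suc n)
  let ?S = "{t. nodes t \<le> n}"
  have "{t. nodes t \<le> Suc n} \<subseteq> insert Leaf (Unary ` ?S \<union> (\<lambda>(l, r). Binary l r) ` (?S \<times> ?S))"
  proof
    fix t
    assume "t \<in> {t. nodes t \<le> Suc n}"
    then show "t \<in> insert Leaf (Unary ` ?S \<union> (\<lambda>(l, r). Binary l r) ` (?S \<times> ?S))"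
      by (cases t) (auto simp: image_iff)
  qed
  moreover have "finite (insert Leaf (Unary ` ?S \<union> (\<lambda>(l, r). Binary l r) ` (?S \<times> ?S)))"
    using Suc by auto
  ultimately show ?case
    by (rule finite_subset)
qed

(* Hence the cardinalities in the definition of B are genuine counts. *)
lemma finite_motzkin_const_nodes: "finite {t \<in> motzkin_const k. nodes t = n}"
  by (rule finite_subset [OF _ finite_motzkin_nodes_le [of n]]) auto

end

theory Submission
  imports Defs "HOL-Complex_Analysis.Complex_Analysis" "HOL-Real_Asymp.Real_Asymp"
begin

text \<open>
  Put \<open>x = 2z\<close>, \<open>\<beta>\<^sub>k = 1/2\<^sup>k\<^sup>+\<^sup>1\<close> and \<open>g\<^sub>k(x) = 1 - x B\<^sub>k(x/2)\<close>. The quadratic equations for \<open>B\<^sub>k\<close> become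
  \<open>g\<^sub>0\<^sup>2 = 1 - x\<^sup>2\<close> and \<open>g\<^sub>k\<^sub>+\<^sub>1\<^sup>2 = 1 - x + x g\<^sub>k\<close>. Since \<open>\<beta>\<^sub>k = 2 \<beta>\<^sub>k\<^sub>+\<^sub>1\<close>, the factors \<open>h\<^sub>k = g\<^sub>k / (1 - x)\<^bsup>\<beta>\<^sub>k\<^esup>\<close>
  satisfy \<open>h\<^sub>k\<^sub>+\<^sub>1\<^sup>2 = (1 - x)\<^bsup>1 - \<beta>\<^sub>k\<^esup> + x h\<^sub>k\<close>, where \<open>1 - \<beta>\<^sub>k \<ge> 1/2\<close>. For \<open>k \<ge> 1\<close> the function \<open>h\<^sub>k\<close> is bounded
  away from \<open>0\<close> on the unit disc, hence inductively \<open>h\<^sub>k'' = O(\<bar>1 - x\<^sup>2\<bar>\<^bsup>-3/2\<^esup>)\<close>, and Cauchy's formula on the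
  circle of radius \<open>1 - 1/n\<close> bounds the coefficients of \<open>h\<^sub>k\<close> by \<open>O(n\<^bsup>-3/2\<^esup>)\<close>. This is of smaller order than
  the coefficients of \<open>(1 - x)\<^bsup>\<beta>\<^sub>k\<^esup>\<close>, so those of the product \<open>g\<^sub>k\<close> are asymptotically the coefficients of
  \<open>(1 - x)\<^bsup>\<beta>\<^sub>k\<^esup>\<close> times \<open>h\<^sub>k(1) = 2\<^bsup>\<beta>\<^sub>k\<^esup>\<close>. No continuation beyond the disc is needed.
\<close>

unbundle no vec_syntax

section \<open>Functional equations of the counting series\<close>

lemma unary_heights_nonempty: "unary_heights t \<noteq> []"
  by (induction t) auto

lemma Leaf_in_motzkin_const_iff: "Leaf \<in> motzkin_const k \<longleftrightarrow> k = 0"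
  by (auto simp: motzkin_const_def)

text \<open>A unary node raises every height by one, so its subtree has constant height k - 1. The
  existence of a leaf matters: with an empty list of heights the case k = 0 would hold
  vacuously.\<close>

lemma Unary_in_motzkin_const_iff:
  "Unary t \<in> motzkin_const k \<longleftrightarrow> (\<exists>j. k = Suc j \<and> t \<in> motzkin_const j)"
proof -
  obtain h where "h \<in> set (unary_heights t)"
    using unary_heights_nonempty by (metis list.set_intros(1) neq_Nil_conv)
  then show ?thesis
    by (cases k) (auto simp: motzkin_const_def)
qed

lemma Binary_in_motzkin_const_iff:
  "Binary l r \<in> motzkin_const k \<longleftrightarrow> l \<in> motzkin_const k \<and> r \<in> motzkin_const k"
  by (auto simp: motzkin_const_def)

lemma nodes_pos: "nodes t > 0"
  by (cases t) auto

lemma B_nth: "B k $ n = real (card {t \<in> motzkin_const k. nodes t = n})"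
  by (simp add: B_def)

lemma B_nth_0: "B k $ 0 = 0"
  by (simp add: B_def nodes_pos less_imp_neq [OF nodes_pos, symmetric])

text \<open>A binary tree of size n + 1 is a pair of subtrees whose sizes add up to n. The pieces of
  the union are disjoint because i is the size of the left subtree.\<close>

lemma card_Binary_motzkin_const:
  "card {t \<in> motzkin_const k. nodes t = Suc n \<and> (\<exists>l r. t = Binary l r)} =
    (\<Sum>i=0..n. card {t \<in> motzkin_const k. nodes t = i} *
              card {t \<in> motzkin_const k. nodes t = n - i})"
proof -
  define N where "N i = {t \<in> motzkin_const k. nodes t = i}" for i
  have fin: "finite (N i)" for i
    unfolding N_def by (rule finite_motzkin_const_nodes)
  have "{t \<in> motzkin_const k. nodes t = Suc n \<and> (\<exists>l r. t = Binary l r)} =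
      case_prod Binary ` (\<Union>i\<in>{0..n}. N i \<times> N (n - i))"
    by (force simp: N_def Binary_in_motzkin_const_iff image_iff)
  moreover have "inj_on (case_prod Binary) A" for A
    by (auto simp: inj_on_def)
  moreover have "card (\<Union>i\<in>{0..n}. N i \<times> N (n - i)) = (\<Sum>i=0..n. card (N i \<times> N (n - i)))"
    by (rule card_UN_disjoint) (use fin in \<open>auto simp: N_def\<close>)
  ultimately show ?thesis
    by (simp add: card_image card_cartesian_product N_def)
qed

lemma B_square_nth:
  "(B k * B k) $ n =
    real (card {t \<in> motzkin_const k. nodes t = Suc n \<and> (\<exists>l r. t = Binary l r)})"
  unfolding card_Binary_motzkin_const by (simp add: fps_mult_nth B_def)

text \<open>A unary root would put every leaf at height at least 1, so the root is either the only
  node, counted by \<open>fps_X\<close>, or binary.\<close>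

lemma B_0_eq: "B 0 = fps_X + fps_X * (B 0 * B 0)"
proof (rule fps_ext)
  fix n
  show "B 0 $ n = (fps_X + fps_X * (B 0 * B 0)) $ n"
  proof (cases n)
    case 0
    then show ?thesis by (simp add: B_nth_0)
  next
    case (Suc m)
    have "{t \<in> motzkin_const 0. nodes t = Suc m} =
        (if m = 0 then {Leaf} else {}) \<union>
        {t \<in> motzkin_const 0. nodes t = Suc m \<and> (\<exists>l r. t = Binary l r)}"
      (is "_ = ?L \<union> ?R")
    proof (rule set_eqI)
      fix t show "t \<in> {t \<in> motzkin_const 0. nodes t = Suc m} \<longleftrightarrow> t \<in> ?L \<union> ?R"
        by (cases t) (auto simp: Leaf_in_motzkin_const_iff Unary_in_motzkin_const_iff)
    qed
    moreover have "finite ?R"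
      by (rule finite_subset [OF _ finite_motzkin_const_nodes [of 0 "Suc m"]]) auto
    ultimately have "card {t \<in> motzkin_const 0. nodes t = Suc m} = card ?L + card ?R"
      by (auto intro!: card_Un_disjoint)
    then show ?thesis
      by (simp add: Suc B_square_nth B_nth [of 0 "Suc m"] del: fps_mult_nth_0)
  qed
qed

text \<open>A lone leaf has height 0 and drops out. Deleting a unary root lowers all heights and the
  size by one, whence \<open>fps_X * B k\<close>.\<close>

lemma B_Suc_eq: "B (Suc k) = fps_X * B k + fps_X * (B (Suc k) * B (Suc k))"
proof (rule fps_ext)
  fix n
  show "B (Suc k) $ n = (fps_X * B k + fps_X * (B (Suc k) * B (Suc k))) $ n"
  proof (cases n)
    case 0
    then show ?thesis by (simp add: B_nth_0)
  next
    case (Suc m)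
    have "{t \<in> motzkin_const (Suc k). nodes t = Suc m} =
        Unary ` {t \<in> motzkin_const k. nodes t = m} \<union>
        {t \<in> motzkin_const (Suc k). nodes t = Suc m \<and> (\<exists>l r. t = Binary l r)}"
      (is "_ = ?L \<union> ?R")
    proof (rule set_eqI)
      fix t show "t \<in> {t \<in> motzkin_const (Suc k). nodes t = Suc m} \<longleftrightarrow> t \<in> ?L \<union> ?R"
        by (cases t) (auto simp: Leaf_in_motzkin_const_iff Unary_in_motzkin_const_iff)
    qed
    moreover have "finite ?R"
      by (rule finite_subset [OF _ finite_motzkin_const_nodes [of "Suc k" "Suc m"]]) auto
    moreover have "finite ?L"
      by (rule finite_imageI, rule finite_motzkin_const_nodes)
    ultimately have "card {t \<in> motzkin_const (Suc k). nodes t = Suc m} = card ?L + card ?R"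
      by (auto intro!: card_Un_disjoint)
    moreover have "card ?L = card {t \<in> motzkin_const k. nodes t = m}"
      by (intro card_image inj_onI) auto
    ultimately show ?thesis
      by (simp add: Suc B_square_nth B_nth [of k m] B_nth [of "Suc k" "Suc m"] del: fps_mult_nth_0)
  qed
qed

section \<open>Rescaled series and their quadratic equations\<close>

text \<open>The rescaling \<open>x = 2z\<close> moves the dominant singularity to \<open>x = 1\<close>.\<close>

definition branch_fps :: "nat \<Rightarrow> complex fps" where
  "branch_fps k = 1 - fps_X * Abs_fps (\<lambda>n. of_real (B k $ n / 2 ^ n))"

lemma branch_fps_nth_0: "branch_fps k $ 0 = 1"
  by (simp add: branch_fps_def)

lemma branch_fps_nth_Suc: "branch_fps k $ Suc n = - of_real (B k $ n / 2 ^ n)"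
  by (simp add: branch_fps_def)

lemma fps_scale_mult:
  fixes F G :: "real fps"
  shows "Abs_fps (\<lambda>n. of_real ((F * G) $ n / 2 ^ n)) =
    Abs_fps (\<lambda>n. of_real (F $ n / 2 ^ n)) * (Abs_fps (\<lambda>n. of_real (G $ n / 2 ^ n)) :: complex fps)"
proof (rule fps_ext)
  fix n
  have "of_real ((F * G) $ n / 2 ^ n) =
      (\<Sum>i=0..n. of_real (F $ i * G $ (n - i)) / (2 ^ n :: complex))"
    by (simp add: fps_mult_nth sum_divide_distrib)
  also have "\<dots> = (\<Sum>i=0..n. of_real (F $ i / 2 ^ i) * of_real (G $ (n - i) / 2 ^ (n - i)))"
    by (rule sum.cong) (auto simp flip: power_add)
  finally show "Abs_fps (\<lambda>n. of_real ((F * G) $ n / 2 ^ n)) $ n =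
      (Abs_fps (\<lambda>n. of_real (F $ n / 2 ^ n)) * (Abs_fps (\<lambda>n. of_real (G $ n / 2 ^ n)) :: complex fps)) $ n"
    by (simp add: fps_mult_nth)
qed

text \<open>Each term on the right carries one factor z = x/2; clearing the denominator leaves the 2
  on the left. The equation of \<open>B 0\<close> is the instance F = 1.\<close>

lemma fps_scale_X_plus:
  fixes F G :: "real fps"
  assumes "H = fps_X * F + fps_X * G"
  shows "2 * Abs_fps (\<lambda>n. of_real (H $ n / 2 ^ n)) =
    fps_X * Abs_fps (\<lambda>n. of_real (F $ n / 2 ^ n)) +
    (fps_X * Abs_fps (\<lambda>n. of_real (G $ n / 2 ^ n)) :: complex fps)"
proof (rule fps_ext)
  fix n
  show "(2 * Abs_fps (\<lambda>n. of_real (H $ n / 2 ^ n))) $ n =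
    (fps_X * Abs_fps (\<lambda>n. of_real (F $ n / 2 ^ n)) +
    (fps_X * Abs_fps (\<lambda>n. of_real (G $ n / 2 ^ n)) :: complex fps)) $ n"
    unfolding assms numeral_fps_const fps_mult_left_const_nth by (cases n) (auto simp: field_simps)
qed

text \<open>Completing the square: with f the rescaled series, (1 - x f)^2 = 1 - x (2 f) + x^2 f^2,
  and inserting 2 f = x + x f^2 cancels the terms in f. The successor case works the same
  way.\<close>

lemma branch_fps_0_square: "branch_fps 0 * branch_fps 0 = 1 - fps_X * fps_X"
proof -
  define f where "f = (Abs_fps (\<lambda>n. of_real (B 0 $ n / 2 ^ n)) :: complex fps)"
  have "Abs_fps (\<lambda>n. of_real ((1::real fps) $ n / 2 ^ n)) = (1 :: complex fps)"
    by (rule fps_ext) auto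
  then have "2 * f = fps_X + fps_X * (f * f)"
    using fps_scale_X_plus [of "B 0" 1 "B 0 * B 0"] B_0_eq fps_scale_mult [of "B 0" "B 0"]
    by (simp add: f_def)
  moreover have "branch_fps 0 * branch_fps 0 = 1 - fps_X * (2 * f) + fps_X * (fps_X * (f * f))"
    by (simp add: branch_fps_def f_def algebra_simps)
  ultimately show ?thesis
    by (simp add: algebra_simps)
qed

lemma branch_fps_Suc_square: "branch_fps (Suc k) * branch_fps (Suc k) = 1 - fps_X + fps_X * branch_fps k"
proof -
  define f where "f j = (Abs_fps (\<lambda>n. of_real (B j $ n / 2 ^ n)) :: complex fps)" for j
  have "2 * f (Suc k) = fps_X * f k + fps_X * (f (Suc k) * f (Suc k))"
    using fps_scale_X_plus [OF B_Suc_eq [of k]] fps_scale_mult [of "B (Suc k)" "B (Suc k)"]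
    by (simp add: f_def)
  moreover have "branch_fps (Suc k) * branch_fps (Suc k) =
      1 - fps_X * (2 * f (Suc k)) + fps_X * (fps_X * (f (Suc k) * f (Suc k)))"
    by (simp add: branch_fps_def f_def algebra_simps)
  moreover have "branch_fps k = 1 - fps_X * f k"
    by (simp add: branch_fps_def f_def)
  ultimately show ?thesis
    by (simp only:) (simp add: algebra_simps)
qed

text \<open>Power series form an integral domain, and F + G has constant term 2, so the factor F - G
  must vanish. The constant term 1 thus selects the branch of a square root.\<close>

lemma fps_square_eq_imp_eq:
  fixes F G :: "complex fps"
  assumes "F * F = G * G" "F $ 0 = 1" "G $ 0 = 1"
  shows "F = G"
proof -
  have "(F - G) * (F + G) = 0"
    using assms(1) by (simp add: algebra_simps)
  moreover have "(F + G) $ 0 \<noteq> 0"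
    using assms by simp
  then have "F + G \<noteq> 0"
    by (metis fps_zero_nth)
  ultimately show ?thesis
    by simp
qed

section \<open>Coefficients of a product\<close>

text \<open>The sum is split at j = n/2. For small j, dominated convergence yields the limit; for
  large j, the decay of h gives O(n^(-q)) against the absolutely summable a, and p < q makes this
  negligible.\<close>

lemma convolution_tendsto:
  fixes a h :: "nat \<Rightarrow> real"
  assumes a: "(\<lambda>n. real n powr p * a n) \<longlonglongrightarrow> L"
    and p: "1 < p" "p < q"
    and h: "\<And>n. n > 0 \<Longrightarrow> \<bar>h n\<bar> \<le> C * real n powr - q"
  shows "(\<lambda>n. real n powr p * (\<Sum>j\<le>n. h j * a (n - j))) \<longlonglongrightarrow> (\<Sum>j. h j) * L"
proof -
  obtain M where M: "M > 0" "\<And>n. \<bar>real n powr p * a n\<bar> \<le> M"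
    using convergent_imp_Bseq [OF convergentI [OF a]] by (auto simp: Bseq_def)
  have sum_q: "summable (\<lambda>n. real n powr - q)" and sum_p: "summable (\<lambda>n. real n powr - p)"
    using p by (auto simp: summable_real_powr_iff)
  have sum_h: "summable (\<lambda>n. \<bar>h n\<bar>)"
    by (rule summable_comparison_test' [where N = 1, OF summable_mult [OF sum_q, of C]]) (use h in auto)
  have bound_a: "\<bar>a n\<bar> \<le> M * real n powr - p" if "n > 0" for n
    using M(2) [of n] that by (simp add: abs_mult powr_minus field_simps)
  have sum_a: "summable (\<lambda>n. \<bar>a n\<bar>)"
    by (rule summable_comparison_test' [where N = 1, OF summable_mult [OF sum_p, of M]])
      (use bound_a in auto)
  \<comment> \<open>The cutoff at n/2 sits inside T, so that Tannery's theorem can sum over all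
    j.\<close>
  define T where "T j n = (if 2 * j \<le> n then real n powr p * (h j * a (n - j)) else 0)" for j n
  have lim1: "((\<lambda>n. \<Sum>j. T j n) \<longlongrightarrow> (\<Sum>j. h j * L)) sequentially"
  proof (rule conjunct2 [OF conjunct2 [OF tannerys_theorem]])
    show "((\<lambda>n. T j n) \<longlongrightarrow> h j * L) sequentially" for j
    proof (rule Lim_transform_eventually)
      have 1: "(\<lambda>n. (real n / real (n - j)) powr p) \<longlonglongrightarrow> 1 powr p"
      proof (rule tendsto_powr)
        have "(\<lambda>n. 1 / (1 - real j / real n)) \<longlonglongrightarrow> 1"
          by (auto intro!: tendsto_eq_intros lim_const_over_n)
        then show "(\<lambda>n. real n / real (n - j)) \<longlonglongrightarrow> 1"
          by (rule Lim_transform_eventually [OF _ eventually_mono [OF eventually_gt_at_top [of j]]])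
            (auto simp: field_simps of_nat_diff)
      qed auto
      have 2: "(\<lambda>n. real (n - j) powr p * a (n - j)) \<longlonglongrightarrow> L"
        using a by (rule filterlim_compose) (rule filterlim_minus_const_nat_at_top)
      show "(\<lambda>n. (real n / real (n - j)) powr p *
          (h j * (real (n - j) powr p * a (n - j)))) \<longlonglongrightarrow> h j * L"
        using tendsto_mult [OF 1 tendsto_mult [OF tendsto_const 2]] by simp
      show "\<forall>\<^sub>F n in sequentially. (real n / real (n - j)) powr p *
          (h j * (real (n - j) powr p * a (n - j))) = T j n"
        using eventually_gt_at_top [of "2 * j"]
        by eventually_elim (auto simp: T_def powr_divide)
    qed
    show "\<forall>\<^sub>F (j, n) in at_top \<times>\<^sub>F sequentially. norm (T j n) \<le> 2 powr p * M * \<bar>h j\<bar>"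
    proof (intro always_eventually allI, clarify)
      fix j n
      show "norm (T j n) \<le> 2 powr p * M * \<bar>h j\<bar>"
      proof (cases "2 * j \<le> n \<and> n > 0")
        case True
        \<comment> \<open>For 2 j <= n one has n <= 2 (n - j); this costs the factor 2^p and makes
          the bound on T uniform in n.\<close>
        then have "real n powr p \<le> (2 * real (n - j)) powr p"
          using p by (intro powr_mono2) auto
        then have "real n powr p * \<bar>a (n - j)\<bar> \<le> 2 powr p * (real (n - j) powr p * \<bar>a (n - j)\<bar>)"
          by (simp add: powr_mult mult_right_mono flip: mult.assoc)
        also have "\<dots> \<le> 2 powr p * M"
          using M(2) [of "n - j"] by (intro mult_left_mono) (auto simp: abs_mult)
        finally have "real n powr p * \<bar>a (n - j)\<bar> * \<bar>h j\<bar> \<le> 2 powr p * M * \<bar>h j\<bar>"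
          by (rule mult_right_mono) simp
        then show ?thesis
          using True by (simp add: T_def abs_mult mult_ac)
      qed (use M(1) in \<open>auto simp: T_def\<close>)
    qed
    show "summable (\<lambda>j. 2 powr p * M * \<bar>h j\<bar>)"
      using sum_h by (rule summable_mult)
  qed auto
  have lim2: "(\<lambda>n. real n powr p * (\<Sum>j | j \<le> n \<and> \<not> 2 * j \<le> n. h j * a (n - j))) \<longlonglongrightarrow> 0"
  proof (rule Lim_null_comparison)
    have "(\<lambda>n. real n powr (p - q)) \<longlonglongrightarrow> 0"
      using p by real_asymp
    then show "(\<lambda>n. real n powr (p - q) * (\<bar>C\<bar> * 2 powr q * (\<Sum>j. \<bar>a j\<bar>))) \<longlonglongrightarrow> 0"
      by (rule tendsto_mult_left_zero)
    show "\<forall>\<^sub>F n in sequentially. norm (real n powr p * (\<Sum>j | j \<le> n \<and> \<not> 2 * j \<le> n. h j * a (n - j)))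
        \<le> real n powr (p - q) * (\<bar>C\<bar> * 2 powr q * (\<Sum>j. \<bar>a j\<bar>))"
      using eventually_gt_at_top [of 0]
    proof eventually_elim
      case (elim n)
      \<comment> \<open>Beyond n/2 the decreasing power of j is at most its value at n/2, so the
        bound depends on n only. Such j are positive, as the hypothesis on h requires.\<close>
      have bound_h: "\<bar>h j\<bar> \<le> \<bar>C\<bar> * 2 powr q * real n powr - q" if "\<not> 2 * j \<le> n" for j
      proof -
        have "real j powr - q \<le> (real n / 2) powr - q"
          using that p elim by (intro powr_mono2') auto
        also have "\<dots> = 2 powr q * real n powr - q"
          by (simp add: powr_divide powr_minus field_simps)
        finally have "\<bar>C\<bar> * real j powr - q \<le> \<bar>C\<bar> * (2 powr q * real n powr - q)"
          by (rule mult_left_mono) auto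
        moreover have "C * real j powr - q \<le> \<bar>C\<bar> * real j powr - q"
          by (intro mult_right_mono) auto
        moreover have "\<bar>h j\<bar> \<le> C * real j powr - q"
          using h [of j] that by simp
        ultimately show ?thesis
          unfolding mult.assoc by linarith
      qed
      have "\<bar>\<Sum>j | j \<le> n \<and> \<not> 2 * j \<le> n. h j * a (n - j)\<bar> \<le>
          (\<Sum>j | j \<le> n \<and> \<not> 2 * j \<le> n. \<bar>C\<bar> * 2 powr q * real n powr - q * \<bar>a (n - j)\<bar>)"
        by (intro order_trans [OF sum_abs] sum_mono)
          (use bound_h in \<open>auto simp: abs_mult intro!: mult_right_mono\<close>)
      also have "\<dots> \<le> (\<Sum>j\<le>n. \<bar>C\<bar> * 2 powr q * real n powr - q * \<bar>a (n - j)\<bar>)"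
        by (rule sum_mono2) auto
      also have "\<dots> = \<bar>C\<bar> * 2 powr q * real n powr - q * (\<Sum>j\<le>n. \<bar>a (n - j)\<bar>)"
        by (simp add: sum_distrib_left)
      also have "(\<Sum>j\<le>n. \<bar>a (n - j)\<bar>) = (\<Sum>j\<le>n. \<bar>a j\<bar>)"
        by (rule sum.reindex_bij_witness [of _ "\<lambda>j. n - j" "\<lambda>j. n - j"]) auto
      also have "\<dots> \<le> (\<Sum>j. \<bar>a j\<bar>)"
        by (rule sum_le_suminf [OF sum_a]) auto
      finally have "\<bar>\<Sum>j | j \<le> n \<and> \<not> 2 * j \<le> n. h j * a (n - j)\<bar> \<le>
          \<bar>C\<bar> * 2 powr q * real n powr - q * (\<Sum>j. \<bar>a j\<bar>)"
        by (simp add: mult_left_mono)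
      then have "real n powr p * \<bar>\<Sum>j | j \<le> n \<and> \<not> 2 * j \<le> n. h j * a (n - j)\<bar> \<le>
          real n powr p * (\<bar>C\<bar> * 2 powr q * real n powr - q * (\<Sum>j. \<bar>a j\<bar>))"
        by (rule mult_left_mono) auto
      then show ?case
        by (simp add: abs_mult powr_diff powr_minus field_simps)
    qed
  qed
  have split: "(\<Sum>j. T j n) + real n powr p * (\<Sum>j | j \<le> n \<and> \<not> 2 * j \<le> n. h j * a (n - j)) =
      real n powr p * (\<Sum>j\<le>n. h j * a (n - j))" for n
  proof -
    have "(\<Sum>j. T j n) = (\<Sum>j | 2 * j \<le> n. T j n)"
      by (rule suminf_finite) (auto simp: T_def intro: finite_subset [of _ "{..n}"])
    also have "\<dots> = real n powr p * (\<Sum>j | 2 * j \<le> n. h j * a (n - j))"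
      by (simp add: T_def sum_distrib_left)
    finally show ?thesis
      by (simp flip: distrib_left) (subst sum.union_disjoint [symmetric],
        auto intro!: sum.cong finite_subset [of "{j. 2 * j \<le> n}" "{..n}"])
  qed
  have "(\<Sum>j. h j * L) = (\<Sum>j. h j) * L"
    by (rule suminf_mult2 [symmetric, OF summable_rabs_cancel [OF sum_h]])
  then show ?thesis
    using tendsto_add [OF lim1 lim2] by (simp add: split)
qed

section \<open>Coefficient bounds from the second derivative\<close>

text \<open>On either side of c an antiderivative is a multiple of the power -1/2, and each side
  contributes at most 2 \<delta>^(-1/2). The integrand models |1 - x^2|^(-3/2) near a singular angle
  on the circle of radius 1 - \<delta>.\<close>

lemma integral_shifted_powr_le:
  fixes c \<delta> :: real
  assumes "\<delta> > 0" "0 \<le> c" "c \<le> 1"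
  obtains I where "((\<lambda>t. (\<delta> + \<bar>t - c\<bar>) powr (-3/2)) has_integral I) {0..1}"
    and "I \<le> 4 * \<delta> powr (-1/2)"
proof
  have "((\<lambda>t. (\<delta> + \<bar>t - c\<bar>) powr (-3/2)) has_integral
      (-2 * (\<delta> + 1 - c) powr (-1/2)) - (-2 * (\<delta> + c - c) powr (-1/2))) {c..1}"
  proof (rule fundamental_theorem_of_calculus)
    fix t assume "t \<in> {c..1}"
    then have "((\<lambda>t. -2 * (\<delta> + t - c) powr (-1/2)) has_real_derivative
        (\<delta> + \<bar>t - c\<bar>) powr (-3/2)) (at t within {c..1})"
      using assms by (auto intro!: derivative_eq_intros simp: algebra_simps)
    then show "((\<lambda>t. -2 * (\<delta> + t - c) powr (-1/2)) has_vector_derivative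
        (\<delta> + \<bar>t - c\<bar>) powr (-3/2)) (at t within {c..1})"
      by (simp only: has_real_derivative_iff_has_vector_derivative)
  qed (use assms in auto)
  moreover have "((\<lambda>t. (\<delta> + \<bar>t - c\<bar>) powr (-3/2)) has_integral
      (2 * (\<delta> + c - c) powr (-1/2)) - (2 * (\<delta> + c - 0) powr (-1/2))) {0..c}"
  proof (rule fundamental_theorem_of_calculus)
    fix t assume "t \<in> {0..c}"
    then have "((\<lambda>t. 2 * (\<delta> + c - t) powr (-1/2)) has_real_derivative
        (\<delta> + \<bar>t - c\<bar>) powr (-3/2)) (at t within {0..c})"
      using assms by (auto intro!: derivative_eq_intros simp: algebra_simps)
    then show "((\<lambda>t. 2 * (\<delta> + c - t) powr (-1/2)) has_vector_derivative
        (\<delta> + \<bar>t - c\<bar>) powr (-3/2)) (at t within {0..c})"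
      by (simp only: has_real_derivative_iff_has_vector_derivative)
  qed (use assms in auto)
  ultimately show "((\<lambda>t. (\<delta> + \<bar>t - c\<bar>) powr (-3/2)) has_integral
      ((2 * (\<delta> + c - c) powr (-1/2)) - (2 * (\<delta> + c - 0) powr (-1/2))) +
      ((-2 * (\<delta> + 1 - c) powr (-1/2)) - (-2 * (\<delta> + c - c) powr (-1/2)))) {0..1}"
    using assms by (intro has_integral_combine)
  show "((2 * (\<delta> + c - c) powr (-1/2)) - (2 * (\<delta> + c - 0) powr (-1/2))) +
      ((-2 * (\<delta> + 1 - c) powr (-1/2)) - (-2 * (\<delta> + c - c) powr (-1/2))) \<le> 4 * \<delta> powr (-1/2)"
    by simp (rule order_trans [of _ 0]; simp)
qed

text \<open>With x = 2 pi d, up to angle pi/3 one has sin x >= x cos x >= x/2 = pi d >= d. From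
  there to pi/2 the sine is at least sin(pi/6) = 1/2, which exceeds 1/4 >= d.\<close>

lemma sin_2pi_ge:
  fixes d :: real
  assumes "0 \<le> d" "d \<le> 1/4"
  shows "d \<le> sin (2 * pi * d)"
proof (cases "d \<le> 1/6")
  case True
  define x where "x = 2 * pi * d"
  have x: "0 \<le> x" "x \<le> pi / 3"
    using assms True by (auto simp: x_def field_simps)
  then have "x < pi / 2"
    using pi_gt_zero by linarith
  have c: "cos x \<ge> 1 / 2"
    using cos_monotone_0_pi_le [of x "pi / 3"] x pi_gt_zero by (simp add: cos_60)
  have "x \<le> tan x"
    using abs_tan_ge [of x] x \<open>x < pi / 2\<close> tan_pos_pi2_le [of x] by auto
  then have "x * cos x \<le> sin x"
    using c by (simp add: tan_def field_simps)
  moreover have "x * (1/2) \<le> x * cos x"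
    using x c by (intro mult_left_mono) auto
  moreover have "d \<le> x * (1/2)"
    using assms mult_right_mono [of 1 pi d] pi_gt3 by (simp add: x_def)
  ultimately have "d \<le> sin x"
    by linarith
  then show ?thesis
    by (simp add: x_def)
next
  case False
  then have "sin (pi / 6) \<le> sin (2 * pi * d)"
    using assms pi_gt_zero by (intro sin_monotone_2pi_le) (auto simp: field_simps)
  then show ?thesis
    using assms by (simp add: sin_30)
qed

text \<open>The points c are the zeros of the sine over one turn of the circle: 0 and 1 both belong
  to the singularity x = 1, and 1/2 belongs to x = -1. Reflections and shifts reduce every quarter
  to \<open>sin_2pi_ge\<close>.\<close>

lemma sin_2pi_ge_dist:
  assumes "t \<in> {0..1}"
  shows "\<exists>c\<in>{0, 1/2, 1}. \<bar>t - c\<bar> \<le> \<bar>sin (2 * pi * t)\<bar>"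
proof -
  consider "t \<le> 1/4" | "1/4 \<le> t" "t \<le> 1/2" | "1/2 \<le> t" "t \<le> 3/4" | "3/4 \<le> t"
    by linarith
  then show ?thesis
  proof cases
    case 1
    then show ?thesis using sin_2pi_ge [of t] assms by auto
  next
    case 2
    have "sin (2 * pi * (1/2 - t)) = sin (pi - 2 * pi * t)"
      by (simp add: algebra_simps)
    then show ?thesis using 2 sin_2pi_ge [of "1/2 - t"] by (auto simp: abs_if)
  next
    case 3
    have "sin (2 * pi * (t - 1/2)) = sin (2 * pi * t - pi)"
      by (simp add: algebra_simps)
    also have "\<dots> = - sin (2 * pi * t)"
      by (simp add: sin_diff)
    finally show ?thesis using 3 sin_2pi_ge [of "t - 1/2"] by (auto simp: abs_if)
  next
    case 4
    have "sin (2 * pi * (1 - t)) = sin (2 * pi - 2 * pi * t)"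
      by (simp add: algebra_simps)
    then show ?thesis using 4 assms sin_2pi_ge [of "1 - t"] by (auto simp: abs_if sin_2pi_minus)
  qed
qed

text \<open>On the unit circle |1 - x^2| is exactly 2 |sin \<theta>|. Moving to radius r changes it
  by at most 1 - r^2, which is itself a lower bound for |1 - x^2|; hence the factor 2 is
  lost.\<close>

lemma norm_one_minus_square_ge:
  assumes "0 < r" "r < 1"
  shows "\<bar>sin \<theta>\<bar> \<le> norm (1 - (of_real r * cis \<theta>)\<^sup>2)"
    and "1 - r \<le> norm (1 - (of_real r * cis \<theta>)\<^sup>2)"
proof -
  let ?x = "of_real r * cis \<theta> :: complex"
  have "1 - r\<^sup>2 \<le> norm (1 - ?x\<^sup>2)"
    using norm_triangle_ineq2 [of 1 "?x\<^sup>2"] by (simp add: norm_mult norm_power)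
  moreover have "r\<^sup>2 \<le> r"
    using assms by (simp add: power2_eq_square)
  ultimately show "1 - r \<le> norm (1 - ?x\<^sup>2)"
    by linarith
  have "1 - (cis \<theta>)\<^sup>2 = cis \<theta> * (cis (- \<theta>) - cis \<theta>)"
    by (simp add: algebra_simps power2_eq_square cis_mult)
  also have "norm \<dots> = norm (cis (- \<theta>) - cis \<theta>)"
    by (simp add: norm_mult)
  also have "cis (- \<theta>) - cis \<theta> = Complex 0 (- 2 * sin \<theta>)"
    by (simp add: complex_eq_iff)
  finally have "2 * \<bar>sin \<theta>\<bar> = norm (1 - (cis \<theta>)\<^sup>2)"
    by (simp add: complex_norm real_sqrt_mult)
  also have "1 - (cis \<theta>)\<^sup>2 = (1 - ?x\<^sup>2) - (of_real (1 - r\<^sup>2)) * (cis \<theta>)\<^sup>2"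
    by (simp add: algebra_simps)
  also have "norm \<dots> \<le> norm (1 - ?x\<^sup>2) + (1 - r\<^sup>2)"
    using assms by (intro order_trans [OF norm_triangle_ineq4]) (simp add: norm_mult norm_power abs_square_le_1 flip: of_real_power of_real_diff)
  finally show "\<bar>sin \<theta>\<bar> \<le> norm (1 - ?x\<^sup>2)"
    using \<open>1 - r\<^sup>2 \<le> norm (1 - ?x\<^sup>2)\<close> by simp
qed

text \<open>Averaging the lower bounds 1 - r and |t - c| for |1 - x^2| reduces the estimate to three
  integrals of at most 4 \<delta>^(-1/2) each. The constant is 6 pi (for the speed 2 pi r) times 3
  (for 2^(3/2)) times 3 * 4.\<close>

lemma norm_contour_integral_circle_le:
  fixes f :: "complex \<Rightarrow> complex"
  assumes r: "0 < r" "r < 1" and "C \<ge> 0"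
    and I: "(f has_contour_integral I) (circlepath 0 r)"
    and f: "\<And>x. norm x = r \<Longrightarrow> norm (f x) \<le> C * norm (1 - x\<^sup>2) powr (-3/2)"
  shows "norm I \<le> 216 * pi * C * (1 - r) powr (-1/2)"
proof -
  define \<delta> where "\<delta> = 1 - r"
  have \<delta>: "\<delta> > 0"
    using r by (simp add: \<delta>_def)
  define \<phi> where "\<phi> c t = (\<delta> + \<bar>t - c\<bar>) powr (-3/2)" for c t :: real
  have "\<exists>J. (\<phi> c has_integral J) {0..1} \<and> J \<le> 4 * \<delta> powr (-1/2)" if "c \<in> {0..1}" for c
    using integral_shifted_powr_le [OF \<delta>, of c] that unfolding \<phi>_def by auto
  then obtain J where J: "\<And>c. c \<in> {0..1} \<Longrightarrow> (\<phi> c has_integral J c) {0..1}"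
    "\<And>c. c \<in> {0..1} \<Longrightarrow> J c \<le> 4 * \<delta> powr (-1/2)"
    by metis
  have "((\<lambda>t. 6 * pi * 3 * C * (\<phi> 0 t + \<phi> (1/2) t + \<phi> 1 t)) has_integral
      6 * pi * 3 * C * (J 0 + J (1/2) + J 1)) {0..1}"
    by (intro has_integral_mult_right has_integral_add J) auto
  moreover have "((\<lambda>t. f (circlepath 0 r t) * vector_derivative (circlepath 0 r) (at t)) has_integral I) {0..1}"
    using I by (simp add: has_contour_integral)
  moreover have "norm (f (circlepath 0 r t) * vector_derivative (circlepath 0 r) (at t)) \<le>
      6 * pi * 3 * C * (\<phi> 0 t + \<phi> (1/2) t + \<phi> 1 t)" if t: "t \<in> {0..1}" for t
  proof -
    define x where "x = circlepath 0 r t"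
    have x: "x = of_real r * cis (2 * pi * t)"
      by (simp add: x_def circlepath cis_conv_exp mult_ac)
    obtain c where c: "c \<in> {0, 1/2, 1}" "\<bar>t - c\<bar> \<le> \<bar>sin (2 * pi * t)\<bar>"
      using sin_2pi_ge_dist [OF t] by blast
    have "(\<delta> + \<bar>t - c\<bar>) / 2 \<le> norm (1 - x\<^sup>2)"
      using add_mono [OF norm_one_minus_square_ge(2) [OF r, of "2 * pi * t"] order_trans [OF c(2) norm_one_minus_square_ge(1) [OF r]]]
      by (simp add: x \<delta>_def mult.commute)
    then have "norm (1 - x\<^sup>2) powr (-3/2) \<le> ((\<delta> + \<bar>t - c\<bar>) / 2) powr (-3/2)"
      using \<delta> by (intro powr_mono2') auto
    also have "\<dots> = 2 powr (3/2) * \<phi> c t"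
      using \<delta> by (simp add: \<phi>_def powr_divide powr_minus divide_simps)
    \<comment> \<open>The zero c depends on t, so the integrable majorant takes all three candidates
      together.\<close>
    also have "\<dots> \<le> 3 * (\<phi> 0 t + \<phi> (1/2) t + \<phi> 1 t)"
    proof (rule mult_mono)
      have "(2::real) powr (3/2) = 2 * sqrt 2"
        using powr_add [of "2::real" 1 "1/2"] by (simp add: powr_half_sqrt)
      also have "sqrt 2 \<le> 3/2"
        by (rule real_le_lsqrt) (auto simp: power2_eq_square)
      finally show "(2::real) powr (3/2) \<le> 3"
        by simp
      show "\<phi> c t \<le> \<phi> 0 t + \<phi> (1/2) t + \<phi> 1 t"
      proof -
        have nonneg: "\<phi> a t \<ge> 0" for a
          by (simp add: \<phi>_def)
        consider "c = 0" | "c = 1/2" | "c = 1"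
          using c(1) by blast
        then show ?thesis
          by cases (use nonneg [of 0] nonneg [of "1/2"] nonneg [of 1] in \<open>hypsubst, linarith\<close>)+
      qed
    qed (auto simp: \<phi>_def)
    finally have "C * norm (1 - x\<^sup>2) powr (-3/2) \<le> C * (3 * (\<phi> 0 t + \<phi> (1/2) t + \<phi> 1 t))"
      using \<open>C \<ge> 0\<close> by (rule mult_left_mono)
    moreover have "norm x = r"
      using r by (simp add: x norm_mult)
    ultimately have f: "norm (f x) \<le> C * (3 * (\<phi> 0 t + \<phi> (1/2) t + \<phi> 1 t))"
      using f [of x] by simp
    have "norm (vector_derivative (circlepath 0 r) (at t)) = 2 * pi * r"
      using r by (simp add: vector_derivative_circlepath norm_mult)
    also have "\<dots> \<le> 6 * pi"
      using r by simp
    finally have "norm (f x) * norm (vector_derivative (circlepath 0 r) (at t)) \<le>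
        C * (3 * (\<phi> 0 t + \<phi> (1/2) t + \<phi> 1 t)) * (6 * pi)"
      using f order_trans [OF norm_ge_zero f] by (intro mult_mono) auto
    then show ?thesis
      by (simp add: x_def norm_mult mult_ac)
  qed
  ultimately have "norm I \<le> 6 * pi * 3 * C * (J 0 + J (1/2) + J 1)"
    by (metis (no_types, lifting) has_integral_integrable integral_norm_bound_integral integral_unique)
  also have "\<dots> \<le> 6 * pi * 3 * C * (4 * \<delta> powr (-1/2) + 4 * \<delta> powr (-1/2) + 4 * \<delta> powr (-1/2))"
    using \<open>C \<ge> 0\<close> by (intro mult_left_mono add_mono J) auto
  finally show ?thesis
    by (simp add: \<delta>_def)
qed

text \<open>Here 1/(1 - 1/n) = 1 + 1/(n - 1) <= exp(1/(n - 1)), and n/(n - 1) <= 2. This keeps the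
  power of 1/r in Cauchy's formula bounded at radius r = 1 - 1/n.\<close>

lemma one_minus_inverse_power_ge:
  assumes "n \<ge> 2"
  shows "inverse ((1 - 1 / real n) ^ n) \<le> exp 2"
proof -
  have "inverse (1 - 1 / real n) = 1 + 1 / (real n - 1)"
    using assms by (simp add: field_simps)
  also have "\<dots> \<le> exp (1 / (real n - 1))"
    by (rule exp_ge_add_one_self)
  finally have "inverse (1 - 1 / real n) ^ n \<le> exp (1 / (real n - 1)) ^ n"
    using assms by (intro power_mono) auto
  also have "\<dots> = exp (real n / (real n - 1))"
    by (simp flip: exp_of_nat_mult)
  also have "\<dots> \<le> exp 2"
    using assms by (simp add: field_simps)
  finally show ?thesis
    by (simp add: power_inverse)
qed

text \<open>Cauchy's formula is applied to f'': its contour integral costs (1 - r)^(-1/2) = n^(1/2),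
  while two differentiations gain n (n - 1), so n^(-3/2) remains.\<close>

lemma fps_nth_bound_of_second_derivative:
  fixes f :: "complex \<Rightarrow> complex"
  assumes F: "f has_fps_expansion F"
    and f': "\<And>x. norm x < 1 \<Longrightarrow> (f has_field_derivative f' x) (at x)"
    and f'': "\<And>x. norm x < 1 \<Longrightarrow> (f' has_field_derivative f'' x) (at x)"
    and bound: "\<And>x. norm x < 1 \<Longrightarrow> norm (f'' x) \<le> C * norm (1 - x\<^sup>2) powr (-3/2)"
  obtains K where "\<And>n. n > 0 \<Longrightarrow> norm (fps_nth F n) \<le> K * real n powr (-3/2)"
proof -
  have C: "C \<ge> 0"
    using order_trans [OF norm_ge_zero bound [of 0]] by simp
  have ev: "\<forall>\<^sub>F x in nhds (0::complex). norm x < 1"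
    using eventually_nhds_in_open [of "ball 0 1" "0::complex"] by simp
  have F'': "f'' has_fps_expansion fps_deriv (fps_deriv F)"
  proof -
    have "deriv f has_fps_expansion fps_deriv F"
      by (rule has_fps_expansion_deriv [OF F])
    moreover have "\<forall>\<^sub>F x in nhds 0. deriv f x = f' x"
      using ev by eventually_elim (rule DERIV_imp_deriv [OF f'])
    ultimately have "f' has_fps_expansion fps_deriv F"
      by (simp cong: has_fps_expansion_cong)
    then have "deriv f' has_fps_expansion fps_deriv (fps_deriv F)"
      by (rule has_fps_expansion_deriv)
    moreover have "\<forall>\<^sub>F x in nhds 0. deriv f' x = f'' x"
      using ev by eventually_elim (rule DERIV_imp_deriv [OF f''])
    ultimately show ?thesis
      by (simp cong: has_fps_expansion_cong)
  qed
  have "f' holomorphic_on ball 0 1"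
    using f'' by (auto simp: holomorphic_on_open intro!: exI)
  then have "deriv f' holomorphic_on ball 0 1"
    by (rule holomorphic_deriv) auto
  then have hol: "f'' holomorphic_on ball 0 1"
    by (rule holomorphic_transform) (use DERIV_imp_deriv [OF f''] in auto)
  \<comment> \<open>The summand |F_1| covers n = 1, where the radius 1 - 1/n would be 0.\<close>
  define M where "M = 2 * (108 * C * exp 2) + norm (fps_nth F 1)"
  have bound_ge_2: "norm (fps_nth F n) \<le> 2 * (108 * C * exp 2) * real n powr (-3/2)" if n: "n \<ge> 2" for n
  proof -
    obtain m where m: "n = m + 2"
      using n by (metis add.commute le_Suc_ex)
    define r where "r = 1 - 1 / real n"
    have r: "0 < r" "r < 1"
      using n by (auto simp: r_def)
    have "((\<lambda>u. f'' u / (u - 0) ^ Suc m) has_contour_integral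
        (2 * pi * \<i>) / fact m * (deriv ^^ m) f'' 0) (circlepath 0 r)"
    proof (rule Cauchy_has_contour_integral_higher_derivative_circlepath)
      show "continuous_on (cball 0 r) f''"
        using hol r by (intro holomorphic_on_imp_continuous_on) (auto elim: holomorphic_on_subset)
      show "f'' holomorphic_on ball 0 r"
        using hol r by (auto elim: holomorphic_on_subset)
    qed (use r in auto)
    moreover have "(2 * pi * \<i>) / fact m * (deriv ^^ m) f'' 0 =
        2 * pi * \<i> * fps_nth (fps_deriv (fps_deriv F)) m"
      unfolding fps_nth_fps_expansion [OF F''] by simp
    ultimately have I: "((\<lambda>u. f'' u / u ^ Suc m) has_contour_integral
        2 * pi * \<i> * fps_nth (fps_deriv (fps_deriv F)) m) (circlepath 0 r)"
      by simp
    have "norm (2 * pi * \<i> * fps_nth (fps_deriv (fps_deriv F)) m) \<le>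
        216 * pi * (C / r ^ Suc m) * (1 - r) powr (-1/2)"
    proof (rule norm_contour_integral_circle_le [OF r _ I])
      show "norm (f'' x / x ^ Suc m) \<le> C / r ^ Suc m * norm (1 - x\<^sup>2) powr (-3/2)" if "norm x = r" for x
        using bound [of x] that r by (simp add: norm_divide norm_power norm_mult divide_right_mono)
    qed (use C r in auto)
    then have "2 * pi * norm (fps_nth (fps_deriv (fps_deriv F)) m) \<le>
        2 * pi * (108 * C * (1 / r ^ Suc m) * (1 - r) powr (-1/2))"
      by (simp add: norm_mult del: fps_deriv_nth)
    then have "norm (fps_nth (fps_deriv (fps_deriv F)) m) \<le> 108 * C * (1 / r ^ Suc m) * (1 - r) powr (-1/2)"
      by (rule mult_left_le_imp_le) simp
    \<comment> \<open>The exponent is m + 1 = n - 1; since r < 1 it may be raised to n.\<close>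
    also have "1 / r ^ Suc m \<le> inverse (r ^ n)"
      using r power_decreasing [of "Suc m" n r] by (simp add: m inverse_eq_divide frac_le)
    also have "\<dots> \<le> exp 2"
      using one_minus_inverse_power_ge [OF n] by (simp add: r_def)
    also have "(1 - r) powr (-1/2) = real n powr (1/2)"
      by (simp add: r_def powr_divide powr_minus divide_simps)
    finally have "norm (fps_nth (fps_deriv (fps_deriv F)) m) \<le> 108 * C * exp 2 * real n powr (1/2)"
      using C by (simp add: mult_left_mono mult_right_mono)
    moreover have "fps_nth (fps_deriv (fps_deriv F)) m = of_nat (n * (n - 1)) * fps_nth F n"
      by (simp add: m algebra_simps)
    ultimately have le: "real (n * (n - 1)) * norm (fps_nth F n) \<le> 108 * C * exp 2 * real n powr (1/2)"
      by (simp only: norm_mult norm_of_nat)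
    \<comment> \<open>The factor 2 comes from n^2 <= 2 n (n - 1), valid for n >= 2.\<close>
    have "real n powr 2 * norm (fps_nth F n) \<le> 2 * (real (n * (n - 1)) * norm (fps_nth F n))"
    proof -
      have "real n powr 2 \<le> 2 * real (n * (n - 1))"
        using n by (simp add: m power2_eq_square algebra_simps)
      then show ?thesis
        by (metis mult.assoc mult_right_mono norm_ge_zero)
    qed
    also have "\<dots> \<le> 2 * (108 * C * exp 2 * real n powr (1/2))"
      by (rule mult_left_mono [OF le]) simp
    finally have "norm (fps_nth F n) \<le> 2 * (108 * C * exp 2) * (real n powr (1/2) / real n powr 2)"
      using n by (simp add: field_simps)
    also have "real n powr (1/2) / real n powr 2 = real n powr (-3/2)"
      by (simp only: powr_diff [symmetric]) simp
    finally show ?thesis .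
  qed
  have "norm (fps_nth F n) \<le> M * real n powr (-3/2)" if "n > 0" for n
  proof (cases "n \<ge> 2")
    case True
    then show ?thesis
      using add_mono [OF bound_ge_2 [of n] mult_nonneg_nonneg [of "norm (fps_nth F 1)" "real n powr (-3/2)"]]
      by (simp add: M_def distrib_right)
  next
    case False
    then have "n = 1"
      using that by simp
    then show ?thesis
      using C by (simp add: M_def)
  qed
  then show ?thesis
    by (rule that)
qed

section \<open>Functions with square-root growth at 1 and -1\<close>

text \<open>The growth of a square root at \<open>x = 1\<close> and \<open>x = -1\<close>, as far as the second derivative.\<close>

definition tame :: "(complex \<Rightarrow> complex) \<Rightarrow> (complex \<Rightarrow> complex) \<Rightarrow> (complex \<Rightarrow> complex) \<Rightarrow> real \<Rightarrow> bool" where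
  "tame f f' f'' C \<longleftrightarrow> C \<ge> 1 \<and> (\<forall>x. norm x < 1 \<longrightarrow>
    (f has_field_derivative f' x) (at x) \<and> (f' has_field_derivative f'' x) (at x) \<and>
    norm (f x) \<le> C \<and> norm (f' x) \<le> C * norm (1 - x\<^sup>2) powr (-1/2) \<and>
    norm (f'' x) \<le> C * norm (1 - x\<^sup>2) powr (-3/2))"

lemma tameD:
  assumes "tame f f' f'' C"
  shows "C \<ge> 1"
    and "norm x < 1 \<Longrightarrow> (f has_field_derivative f' x) (at x)"
    and "norm x < 1 \<Longrightarrow> (f' has_field_derivative f'' x) (at x)"
    and "norm x < 1 \<Longrightarrow> norm (f x) \<le> C"
    and "norm x < 1 \<Longrightarrow> norm (f' x) \<le> C * norm (1 - x\<^sup>2) powr (-1/2)"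
    and "norm x < 1 \<Longrightarrow> norm (f'' x) \<le> C * norm (1 - x\<^sup>2) powr (-3/2)"
  using assms by (auto simp: tame_def)

lemma norm_one_minus_square_disc:
  assumes "norm (x::complex) < 1"
  shows "0 < norm (1 - x\<^sup>2)" "norm (1 - x\<^sup>2) \<le> 2"
proof -
  have "norm (x\<^sup>2) < 1"
    using assms by (simp add: norm_power power_less_one_iff)
  then show "0 < norm (1 - x\<^sup>2)" "norm (1 - x\<^sup>2) \<le> 2"
    using norm_triangle_ineq4 [of 1 "x\<^sup>2"] by auto
qed

text \<open>Since |1 - x^2| lies in (0, 2], lowering an exponent by t - s costs at most 2^(t - s).
  This lets milder singularities be absorbed into the exponents of \<open>tame\<close>.\<close>

lemma norm_one_minus_square_powr_mono:
  assumes "norm (x::complex) < 1" "s \<le> t"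
  shows "norm (1 - x\<^sup>2) powr t \<le> 2 powr (t - s) * norm (1 - x\<^sup>2) powr s"
proof -
  have "norm (1 - x\<^sup>2) powr (t - s) \<le> 2 powr (t - s)"
    using norm_one_minus_square_disc [OF assms(1)] assms(2) by (intro powr_mono2) auto
  then have "norm (1 - x\<^sup>2) powr (t - s) * norm (1 - x\<^sup>2) powr s \<le> 2 powr (t - s) * norm (1 - x\<^sup>2) powr s"
    by (intro mult_right_mono) auto
  then show ?thesis
    by (simp flip: powr_add)
qed

lemma norm_one_minus_square_half_squared:
  "norm (1 - x\<^sup>2) powr (-1/2) * norm (1 - x\<^sup>2) powr (-1/2) = norm (1 - x\<^sup>2 :: complex) powr (-1)"
  by (simp flip: powr_add)

lemma norm_one_minus_square_minus_one_le:
  assumes "norm (x::complex) < 1"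
  shows "norm (1 - x\<^sup>2) powr (-1) \<le> 2 * norm (1 - x\<^sup>2) powr (-3/2)"
proof -
  have "norm (1 - x\<^sup>2) powr (-1) \<le> 2 powr (1/2) * norm (1 - x\<^sup>2) powr (-3/2)"
    using norm_one_minus_square_powr_mono [OF assms, of "-3/2" "-1"] by simp
  also have "2 powr (1/2) \<le> (2::real)"
    using powr_mono [of "1/2" 1 "2::real"] by simp
  finally show ?thesis
    by (simp add: mult_right_mono)
qed

lemma tame_add:
  assumes "tame f f' f'' C" "tame g g' g'' D"
  shows "tame (\<lambda>x. f x + g x) (\<lambda>x. f' x + g' x) (\<lambda>x. f'' x + g'' x) (C + D)"
  unfolding tame_def
proof (intro conjI allI impI)
  fix x :: complex assume x: "norm x < 1"
  note f = tameD [OF assms(1)] and g = tameD [OF assms(2)]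
  show "((\<lambda>x. f x + g x) has_field_derivative f' x + g' x) (at x)"
    "((\<lambda>x. f' x + g' x) has_field_derivative f'' x + g'' x) (at x)"
    using f(2,3) g(2,3) x by (auto intro!: derivative_eq_intros)
  show "norm (f x + g x) \<le> C + D"
    "norm (f' x + g' x) \<le> (C + D) * norm (1 - x\<^sup>2) powr (-1/2)"
    "norm (f'' x + g'' x) \<le> (C + D) * norm (1 - x\<^sup>2) powr (-3/2)"
    using f(4-6) [OF x] g(4-6) [OF x] unfolding distrib_right
    by (blast intro: norm_triangle_mono)+
qed (use tameD(1) [OF assms(1)] tameD(1) [OF assms(2)] in simp)

text \<open>The constant is dictated by the second derivative 2 f' + x f'': raising the growth of f'
  from exponent -1/2 to -3/2 costs a factor 2, giving 4 C + C.\<close>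

lemma tame_ident_mult:
  assumes "tame f f' f'' C"
  shows "tame (\<lambda>x. x * f x) (\<lambda>x. f x + x * f' x) (\<lambda>x. 2 * f' x + x * f'' x) (5 * C)"
  unfolding tame_def
proof (intro conjI allI impI)
  fix x :: complex assume x: "norm x < 1"
  note f = tameD [OF assms]
  define w where "w = norm (1 - x\<^sup>2)"
  have w: "w powr 0 \<le> 2 powr (1/2) * w powr (-1/2)" "w powr (-1/2) \<le> 2 powr 1 * w powr (-3/2)"
    unfolding w_def using norm_one_minus_square_powr_mono [OF x, of "-1/2" 0]
      norm_one_minus_square_powr_mono [OF x, of "-3/2" "-1/2"] by simp_all
  have "2 powr (1/2) \<le> (2::real)"
    using powr_mono [of "1/2" 1 "2::real"] by simp
  then have "2 powr (1/2) * w powr (-1/2) \<le> 2 * w powr (-1/2)"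
    by (rule mult_right_mono) simp
  moreover have "1 \<le> 2 powr (1/2) * w powr (-1/2)"
    using w(1) norm_one_minus_square_disc [OF x] by (simp add: w_def)
  ultimately have w1: "1 \<le> 2 * w powr (-1/2)"
    by linarith
  show "((\<lambda>x. x * f x) has_field_derivative f x + x * f' x) (at x)"
    "((\<lambda>x. f x + x * f' x) has_field_derivative 2 * f' x + x * f'' x) (at x)"
    using f(2,3) x by (auto intro!: derivative_eq_intros simp: algebra_simps)
  have le: "norm (x * y) \<le> norm y" for y
    using x by (simp add: norm_mult mult_left_le_one_le)
  show "norm (x * f x) \<le> 5 * C"
    using le [of "f x"] f(1) f(4) [OF x] by linarith
  have "norm (f x + x * f' x) \<le> C + C * w powr (-1/2)"
    using f(4,5) [OF x] le [of "f' x"] unfolding w_def by (intro norm_triangle_mono) auto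
  moreover have "C \<le> C * (2 * w powr (-1/2))"
    using mult_left_mono [OF w1, of C] f(1) by simp
  ultimately have "norm (f x + x * f' x) \<le> 3 * C * w powr (-1/2)"
    by linarith
  also have "\<dots> \<le> 5 * C * w powr (-1/2)"
    using f(1) by (intro mult_right_mono) auto
  finally show "norm (f x + x * f' x) \<le> 5 * C * norm (1 - x\<^sup>2) powr (-1/2)"
    by (simp add: w_def)
  have "norm (2 * f' x + x * f'' x) \<le> 2 * (C * w powr (-1/2)) + C * w powr (-3/2)"
    using f(5,6) [OF x] le [of "f'' x"] unfolding w_def
    by (intro norm_triangle_mono) (auto simp: norm_mult)
  moreover have "C * w powr (-1/2) \<le> C * (2 * w powr (-3/2))"
    using w(2) f(1) by (intro mult_left_mono) auto
  ultimately show "norm (2 * f' x + x * f'' x) \<le> 5 * C * norm (1 - x\<^sup>2) powr (-3/2)"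
    unfolding w_def by linarith
qed (use tameD(1) [OF assms] in simp)

text \<open>Differentiating h^2 = H gives h' = H'/(2h) and h'' = (H'' - 2 h'^2)/(2h), where the
  lower bound on h controls the division. The square of h' grows with exponent -1, which is milder
  than -3/2.\<close>

lemma tame_sqrt:
  assumes H: "tame H H' H'' C"
    and h: "\<And>x. norm x < 1 \<Longrightarrow> h field_differentiable (at x)"
    and square: "\<And>x. norm x < 1 \<Longrightarrow> h x * h x = H x"
    and lower: "\<And>x. norm x < 1 \<Longrightarrow> c \<le> norm (h x)" and "c > 0"
  shows "\<exists>h' h'' D. tame h h' h'' D"
proof -
  note HD = tameD [OF H]
  have nz: "h x \<noteq> 0" if "norm x < 1" for x
    using lower [OF that] \<open>c > 0\<close> by auto
  define h' where "h' x = H' x / (2 * h x)" for x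
  define h'' where "h'' x = (H'' x - 2 * (h' x)\<^sup>2) / (2 * h x)" for x
  \<comment> \<open>The sum of 1 and the three bounds obtained below for h, h' and h'', so that it
    dominates each of them.\<close>
  define D where "D = 1 + C + C / (2 * c) + (C + 4 * (C / (2 * c))\<^sup>2) / (2 * c)"
  have h': "(h has_field_derivative h' x) (at x)" if x: "norm x < 1" for x
  proof -
    have dh: "(h has_field_derivative deriv h x) (at x)"
      using h [OF x] by (simp add: field_differentiable_derivI)
    then have "((\<lambda>x. h x * h x) has_field_derivative 2 * h x * deriv h x) (at x)"
      by (auto intro!: derivative_eq_intros)
    moreover have "((\<lambda>x. h x * h x) has_field_derivative H' x) (at x)"
      by (rule has_field_derivative_transform_within_open [OF HD(2) [OF x], of "ball 0 1"])
        (use x square in auto)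
    ultimately have "2 * h x * deriv h x = H' x"
      by (rule DERIV_unique)
    then have "deriv h x = h' x"
      using nz [OF x] by (simp add: h'_def field_simps)
    then show ?thesis
      using dh by simp
  qed
  have "tame h h' h'' D"
    unfolding tame_def
  proof (intro conjI allI impI)
    show "D \<ge> 1"
      using HD(1) \<open>c > 0\<close> by (simp add: D_def)
    fix x :: complex assume x: "norm x < 1"
    define w where "w = norm (1 - x\<^sup>2)"
    show "(h has_field_derivative h' x) (at x)"
      by (rule h' [OF x])
    have "((\<lambda>x. H' x / (2 * h x)) has_field_derivative
        (H'' x * (2 * h x) - H' x * (2 * h' x)) / (2 * h x * (2 * h x))) (at x)"
      using h' [OF x] HD(3) [OF x] nz [OF x]
      by (auto intro!: derivative_eq_intros)
    also have "(H'' x * (2 * h x) - H' x * (2 * h' x)) / (2 * h x * (2 * h x)) = h'' x"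
      using nz [OF x] by (simp add: h'_def h''_def field_simps power2_eq_square)
    finally show "(h' has_field_derivative h'' x) (at x)"
      by (simp add: h'_def [abs_def])
    have "norm (h x) * norm (h x) \<le> C"
      using HD(4) [OF x] square [OF x] by (metis norm_mult)
    \<comment> \<open>From |h|^2 <= C and C >= 1 follows |h|^2 <= C^2, which avoids a root in the
      constant.\<close>
    also have "C \<le> C * C"
      using HD(1) by simp
    finally have "norm (h x) \<le> C"
      using HD(1) by (metis abs_le_square_iff abs_of_nonneg norm_ge_zero power2_eq_square zero_le_one order_trans)
    also have "C \<le> D"
      using HD(1) \<open>c > 0\<close> by (simp add: D_def)
    finally show "norm (h x) \<le> D" .
    have "norm (h' x) \<le> (C * w powr (-1/2)) / (2 * c)"
      using HD(5) [OF x] order_trans [OF norm_ge_zero HD(5) [OF x]] lower [OF x] \<open>c > 0\<close>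
      unfolding h'_def w_def norm_divide norm_mult by (intro frac_le) auto
    then have b1: "norm (h' x) \<le> C / (2 * c) * w powr (-1/2)"
      by simp
    also have "\<dots> \<le> D * w powr (-1/2)"
      using HD(1) \<open>c > 0\<close> by (intro mult_right_mono) (simp_all add: D_def)
    finally show "norm (h' x) \<le> D * norm (1 - x\<^sup>2) powr (-1/2)"
      by (simp add: w_def)
    have "(norm (h' x))\<^sup>2 \<le> (C / (2 * c) * w powr (-1/2))\<^sup>2"
      using b1 by (rule power_mono) auto
    also have "\<dots> = (C / (2 * c))\<^sup>2 * w powr (-1)"
      unfolding w_def power_mult_distrib
      by (simp only: power2_eq_square [of "norm _ powr _"] norm_one_minus_square_half_squared)
    also have "\<dots> \<le> (C / (2 * c))\<^sup>2 * (2 * w powr (-3/2))"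
      using norm_one_minus_square_minus_one_le [OF x] unfolding w_def by (rule mult_left_mono) simp
    finally have b2: "(norm (h' x))\<^sup>2 \<le> (C / (2 * c))\<^sup>2 * (2 * w powr (-3/2))" .
    have "norm (H'' x - 2 * (h' x)\<^sup>2) \<le> norm (H'' x) + 2 * (norm (h' x))\<^sup>2"
      by (rule order_trans [OF norm_triangle_ineq4]) (simp add: norm_mult norm_power)
    also have "\<dots> \<le> C * w powr (-3/2) + 2 * ((C / (2 * c))\<^sup>2 * (2 * w powr (-3/2)))"
      using HD(6) [OF x] b2 unfolding w_def by (intro add_mono mult_left_mono) auto
    also have "\<dots> = (C + 4 * (C / (2 * c))\<^sup>2) * w powr (-3/2)"
      by (simp add: algebra_simps)
    finally have "norm (h'' x) \<le> ((C + 4 * (C / (2 * c))\<^sup>2) * w powr (-3/2)) / (2 * c)"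
      using lower [OF x] \<open>c > 0\<close> HD(1)
      unfolding h''_def norm_divide by (intro frac_le) (auto simp: norm_mult)
    also have "\<dots> = (C + 4 * (C / (2 * c))\<^sup>2) / (2 * c) * w powr (-3/2)"
      by simp
    also have "\<dots> \<le> D * w powr (-3/2)"
      using HD(1) \<open>c > 0\<close> by (intro mult_right_mono) (simp_all add: D_def)
    finally show "norm (h'' x) \<le> D * norm (1 - x\<^sup>2) powr (-3/2)"
      by (simp add: w_def)
  qed
  then show ?thesis
    by blast
qed

text \<open>A nonpositive power reverses the comparison of the bases; the factor 2 in it becomes
  2^(-s), which is at most 4 for s >= -2. In use, y is x or -x.\<close>

lemma norm_one_plus_powr_le:
  fixes x y :: complex
  assumes "norm x < 1" "norm y < 1" "norm (1 - x\<^sup>2) \<le> 2 * norm (1 + y)" and "s \<ge> - 2" "s \<le> 0"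
  shows "norm ((1 + y) powr of_real s) \<le> 4 * norm (1 - x\<^sup>2) powr s"
proof -
  have "1 + y \<noteq> 0"
    using assms(2) by (metis add_eq_0_iff norm_minus_cancel norm_one order_less_irrefl)
  then have "norm ((1 + y) powr of_real s) = norm (1 + y) powr s"
    by (simp add: norm_powr_real_powr')
  also have "\<dots> \<le> (norm (1 - x\<^sup>2) / 2) powr s"
    using assms norm_one_minus_square_disc [OF assms(1)] by (intro powr_mono2') auto
  also have "\<dots> = 2 powr (- s) * norm (1 - x\<^sup>2) powr s"
    by (simp add: powr_divide powr_minus divide_simps)
  also have "2 powr (- s) \<le> (2::real) powr 2"
    using assms by (intro powr_mono) auto
  finally show ?thesis
    by (simp add: mult_right_mono)
qed

text \<open>The sign \<open>e\<close> lets one lemma cover both \<open>(1 - x)\<^sup>s\<close> and the seed \<open>(1 + x)\<^sup>1\<^sup>/\<^sup>2\<close> of the recursion.\<close>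

lemma tame_powr:
  fixes e :: complex
  assumes e: "e = 1 \<or> e = -1" and s: "1/2 \<le> s" "s \<le> 1"
  shows "\<exists>f' f'' C. tame (\<lambda>x. (1 + e * x) powr of_real s) f' f'' C"
proof -
  define f' where "f' x = e * (of_real s * (1 + e * x) powr of_real (s - 1))" for x
  define f'' where "f'' x = e * e * (of_real s * of_real (s - 1) * (1 + e * x) powr of_real (s - 2))" for x
  \<comment> \<open>The value 16 is generous: the estimates below need at most 4 * 2 = 8.\<close>
  have "tame (\<lambda>x. (1 + e * x) powr of_real s) f' f'' 16"
    unfolding tame_def
  proof (intro conjI allI impI)
    fix x :: complex assume x: "norm x < 1"
    have ex: "norm (e * x) < 1"
      using x e by auto
    have nn: "1 + e * x \<notin> \<real>\<^sub>\<le>\<^sub>0"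
    proof
      assume "1 + e * x \<in> \<real>\<^sub>\<le>\<^sub>0"
      then have "Re (1 + e * x) \<le> 0"
        by (simp add: complex_nonpos_Reals_iff)
      then show False
        using abs_Re_le_cmod [of "e * x"] ex by auto
    qed
    have nz: "1 + e * x \<noteq> 0"
      using nn by auto
    have D: "((\<lambda>x. (1 + e * x) powr a) has_field_derivative e * (a * (1 + e * x) powr (a - 1))) (at x)" for a
      using nn by (auto intro!: derivative_eq_intros DERIV_chain' [OF _ has_field_derivative_powr, of "\<lambda>x. 1 + e * x"])
    show "((\<lambda>x. (1 + e * x) powr of_real s) has_field_derivative f' x) (at x)"
      using D [of "of_real s"] by (simp add: f'_def)
    have "((\<lambda>x. e * of_real s * (1 + e * x) powr of_real (s - 1)) has_field_derivative f'' x) (at x)"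
      using DERIV_cmult [OF D [of "of_real (s - 1)"], of "e * of_real s"]
      by (simp add: f''_def mult_ac)
    then show "(f' has_field_derivative f'' x) (at x)"
      by (simp add: f'_def [abs_def] mult_ac)
    have w: "norm (1 - x\<^sup>2) \<le> 2 * norm (1 + e * x)"
    proof -
      have "1 - x\<^sup>2 = (1 - e * x) * (1 + e * x)"
        using e by (auto simp: algebra_simps power2_eq_square)
      then have "norm (1 - x\<^sup>2) = norm (1 - e * x) * norm (1 + e * x)"
        by (simp add: norm_mult)
      also have "\<dots> \<le> 2 * norm (1 + e * x)"
        using norm_triangle_ineq4 [of 1 "e * x"] ex by (intro mult_right_mono) auto
      finally show ?thesis .
    qed
    have "norm ((1 + e * x) powr of_real s) = norm (1 + e * x) powr s"
      using nz by (simp add: norm_powr_real_powr')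
    also have "\<dots> \<le> 2 powr s"
      using norm_triangle_ineq [of 1 "e * x"] ex s by (intro powr_mono2) auto
    also have "\<dots> \<le> 2 powr 1"
      using s by (intro powr_mono) auto
    finally show "norm ((1 + e * x) powr of_real s) \<le> 16"
      by simp
    have [simp]: "norm e = 1" and s': "\<bar>s\<bar> \<le> 1" "\<bar>s - 1\<bar> \<le> 1"
      using e s by auto
    \<comment> \<open>Here s >= 1/2 enters: s - 1 and s - 2 exceed -1/2 and -3/2 by s - 1/2, which
      costs at most a factor 2.\<close>
    have p: "norm (1 - x\<^sup>2) powr (s - 1) \<le> 2 * norm (1 - x\<^sup>2) powr (-1/2)"
      "norm (1 - x\<^sup>2) powr (s - 2) \<le> 2 * norm (1 - x\<^sup>2) powr (-3/2)"
    proof -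
      have "2 powr (s - 1/2) \<le> (2::real) powr 1"
        using s by (intro powr_mono) auto
      then have "2 powr (s - 1/2) * y \<le> 2 * y" if "y \<ge> 0" for y :: real
        using that by (intro mult_right_mono) auto
      then show "norm (1 - x\<^sup>2) powr (s - 1) \<le> 2 * norm (1 - x\<^sup>2) powr (-1/2)"
        "norm (1 - x\<^sup>2) powr (s - 2) \<le> 2 * norm (1 - x\<^sup>2) powr (-3/2)"
        using norm_one_minus_square_powr_mono [OF x, of "-1/2" "s - 1"]
          norm_one_minus_square_powr_mono [OF x, of "-3/2" "s - 2"] s
        by (force intro: order_trans)+
    qed
    have "norm (f' x) \<le> 1 * norm ((1 + e * x) powr of_real (s - 1))"
      unfolding f'_def norm_mult using s' by (simp add: mult_left_le_one_le)
    also have "\<dots> \<le> 4 * norm (1 - x\<^sup>2) powr (s - 1)"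
      using norm_one_plus_powr_le [OF x ex w, of "s - 1"] s by simp
    finally show "norm (f' x) \<le> 16 * norm (1 - x\<^sup>2) powr (-1/2)"
      using p(1) powr_ge_zero [of "norm (1 - x\<^sup>2)" "-1/2"] by linarith
    have "\<bar>s\<bar> * \<bar>s - 1\<bar> \<le> 1"
      using s' by (simp add: mult_le_one)
    then have "\<bar>s\<bar> * \<bar>s - 1\<bar> * norm ((1 + e * x) powr of_real (s - 2)) \<le>
        1 * norm ((1 + e * x) powr of_real (s - 2))"
      by (rule mult_right_mono) simp
    then have "norm (f'' x) \<le> 1 * norm ((1 + e * x) powr of_real (s - 2))"
      by (simp only: f''_def norm_mult norm_of_real \<open>norm e = 1\<close> mult_1)
    also have "\<dots> \<le> 4 * norm (1 - x\<^sup>2) powr (s - 2)"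
      using norm_one_plus_powr_le [OF x ex w, of "s - 2"] s by simp
    finally show "norm (f'' x) \<le> 16 * norm (1 - x\<^sup>2) powr (-3/2)"
      using p(2) powr_ge_zero [of "norm (1 - x\<^sup>2)" "-3/2"] by linarith
  qed auto
  then show ?thesis
    by blast
qed

section \<open>The nested square roots on the unit disc\<close>

declare csqrt.simps [simp del]

text \<open>As 1 - z lies in the right half-plane, its principal root s has argument below pi/4 in
  modulus. Then |1 + s| >= 1, so z = (1 - s)(1 + s) puts 1 - s back into the unit disc; this lets
  the nesting of roots continue.\<close>

lemma csqrt_one_minus:
  assumes "norm z < 1"
  defines "s \<equiv> csqrt (1 - z)"
  shows "1 - z \<notin> \<real>\<^sub>\<le>\<^sub>0" "s * s = 1 - z" "\<bar>Im s\<bar> < Re s" "norm (1 - s) * norm (1 + s) = norm z"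
    "norm (1 - s) < 1"
proof -
  have "Re (1 - z) > 0"
    using assms abs_Re_le_cmod [of z] by simp
  then show "1 - z \<notin> \<real>\<^sub>\<le>\<^sub>0"
    by (auto simp: complex_nonpos_Reals_iff)
  show sq: "s * s = 1 - z"
    using power2_csqrt [of "1 - z"] by (simp add: s_def power2_eq_square)
  have "0 < Re (s * s)"
    unfolding sq by fact
  then have "(Im s)\<^sup>2 < (Re s)\<^sup>2"
    by (simp add: power2_eq_square)
  then have "\<bar>Im s\<bar> < \<bar>Re s\<bar>"
    using abs_le_square_iff [of "Re s" "Im s"] by linarith
  moreover have "Re s \<ge> 0"
    using csqrt_principal [of "1 - z"] by (auto simp: s_def)
  ultimately show s: "\<bar>Im s\<bar> < Re s"
    by simp
  have "z = (1 - s) * (1 + s)"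
    using sq by (simp add: algebra_simps)
  then show n: "norm (1 - s) * norm (1 + s) = norm z"
    by (simp add: norm_mult)
  have "1 \<le> norm (1 + s)"
    using abs_Re_le_cmod [of "1 + s"] s by simp
  then have "norm (1 - s) * 1 \<le> norm (1 - s) * norm (1 + s)"
    by (intro mult_left_mono) auto
  then show "norm (1 - s) < 1"
    using n assms by simp
qed

text \<open>These are the functions g_k. Writing the radicand as 1 - x (1 - g_k) shows it as 1 minus
  a number of modulus below 1, so the cut of \<open>csqrt\<close> is never met in the disc.\<close>

primrec branch :: "nat \<Rightarrow> complex \<Rightarrow> complex" where
  "branch 0 x = csqrt (1 - x * x)"
| "branch (Suc k) x = csqrt (1 - x * (1 - branch k x))"

lemma norm_mult_less_one: "norm (x * y) < 1" if "norm (x::complex) < 1" "norm y < 1"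
  using mult_strict_mono' [of "norm x" 1 "norm y" 1] that by (simp add: norm_mult)

lemma norm_one_minus_branch: "norm (1 - branch k x) < 1" if "norm x < 1"
  by (induction k) (use that in \<open>auto intro!: csqrt_one_minus(5) norm_mult_less_one\<close>)

lemma branch_square:
  assumes "norm x < 1"
  shows "branch 0 x * branch 0 x = 1 - x * x" "branch (Suc k) x * branch (Suc k) x = 1 - x * (1 - branch k x)"
  using assms csqrt_one_minus(2) [OF norm_mult_less_one, of x x]
    csqrt_one_minus(2) [OF norm_mult_less_one [OF _ norm_one_minus_branch], of x x k]
  by simp_all

lemma abs_Im_branch_less: "\<bar>Im (branch k x)\<bar> < Re (branch k x)" if "norm x < 1"
  by (cases k) (use that in \<open>auto intro!: csqrt_one_minus(3) norm_mult_less_one norm_one_minus_branch\<close>)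

lemma norm_one_minus_branch_mult: "norm (1 - branch k x) * norm (1 + branch k x) \<le> 1" if "norm x < 1"
  by (cases k)
    (use that csqrt_one_minus(4) [OF norm_mult_less_one, of x x]
      csqrt_one_minus(4) [OF norm_mult_less_one [OF _ norm_one_minus_branch], of x x "k - 1"]
      norm_mult_less_one [of x x] norm_mult_less_one [OF _ norm_one_minus_branch, of x x "k - 1"]
     in \<open>simp_all\<close>)

lemma branch_field_differentiable: "branch k field_differentiable (at x)" if "norm x < 1"
proof (induction k)
  case 0
  have "((\<lambda>x. csqrt (1 - x * x)) has_field_derivative (- x - x) / (2 * csqrt (1 - x * x))) (at x)"
    using csqrt_one_minus(1) [OF norm_mult_less_one, of x x] that
    by (auto intro!: derivative_eq_intros)
  then show ?case
    by (auto simp: field_differentiable_def)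
next
  case (Suc k)
  then obtain D where "(branch k has_field_derivative D) (at x)"
    by (auto simp: field_differentiable_def)
  then have "((\<lambda>x. csqrt (1 - x * (1 - branch k x))) has_field_derivative
      (x * D - (1 - branch k x)) / (2 * csqrt (1 - x * (1 - branch k x)))) (at x)"
    using csqrt_one_minus(1) [OF norm_mult_less_one [OF _ norm_one_minus_branch], of x x k] that
    by (auto intro!: derivative_eq_intros)
  then show ?case
    by (auto simp: field_differentiable_def)
qed

declare branch.simps [simp del]

text \<open>The Taylor series of the functions and the formal series obey the same recursion for
  their squares and have constant term 1, so \<open>fps_square_eq_imp_eq\<close> identifies them by
  induction.\<close>

lemma branch_has_fps_expansion: "branch k has_fps_expansion branch_fps k"
proof -
  have ev: "\<forall>\<^sub>F x in nhds (0::complex). norm x < 1"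
    using eventually_nhds_in_open [of "ball 0 1" "0::complex"] by simp
  have "branch k holomorphic_on ball 0 1" for k
    using branch_field_differentiable
    by (auto simp: holomorphic_on_def intro: field_differentiable_at_within)
  then have P: "branch k has_fps_expansion fps_expansion (branch k) 0" for k
    by (intro has_fps_expansion_fps_expansion [of "ball 0 1"]) auto
  have P0: "fps_nth (fps_expansion (branch k) 0) 0 = 1" for k
  proof -
    have "branch k 0 = 1"
      by (cases k) (simp_all add: branch.simps)
    then show ?thesis
      using has_fps_expansion_imp_0_eq_fps_nth_0 [OF P, of k] by simp
  qed
  have PP: "(\<lambda>x. branch k x * branch k x) has_fps_expansion fps_expansion (branch k) 0 * fps_expansion (branch k) 0" for k
    by (intro has_fps_expansion_mult P)
  show ?thesis
  proof (induction k)
    case 0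
    have "(\<lambda>x. 1 - x * x) has_fps_expansion (1 - fps_X * fps_X :: complex fps)"
      by (intro fps_expansion_intros)
    moreover have "\<forall>\<^sub>F x in nhds 0. branch 0 x * branch 0 x = 1 - x * x"
      using ev by eventually_elim (rule branch_square)
    ultimately have "(\<lambda>x. branch 0 x * branch 0 x) has_fps_expansion (1 - fps_X * fps_X)"
      by (subst has_fps_expansion_cong) auto
    then have "fps_expansion (branch 0) 0 * fps_expansion (branch 0) 0 = 1 - fps_X * fps_X"
      by (rule fps_expansion_unique_complex [OF PP])
    then have "fps_expansion (branch 0) 0 * fps_expansion (branch 0) 0 = branch_fps 0 * branch_fps 0"
      by (simp only: branch_fps_0_square)
    then have "fps_expansion (branch 0) 0 = branch_fps 0"
      by (rule fps_square_eq_imp_eq [OF _ P0 branch_fps_nth_0])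
    then show ?case
      using P [of 0] by simp
  next
    case (Suc k)
    have "(\<lambda>x. 1 - x * (1 - branch k x)) has_fps_expansion (1 - fps_X * (1 - branch_fps k))"
      by (intro fps_expansion_intros Suc)
    moreover have "\<forall>\<^sub>F x in nhds 0. branch (Suc k) x * branch (Suc k) x = 1 - x * (1 - branch k x)"
      using ev by eventually_elim (rule branch_square)
    ultimately have "(\<lambda>x. branch (Suc k) x * branch (Suc k) x) has_fps_expansion (1 - fps_X * (1 - branch_fps k))"
      by (subst has_fps_expansion_cong) auto
    then have "fps_expansion (branch (Suc k)) 0 * fps_expansion (branch (Suc k)) 0 = 1 - fps_X * (1 - branch_fps k)"
      by (rule fps_expansion_unique_complex [OF PP])
    also have "\<dots> = branch_fps (Suc k) * branch_fps (Suc k)"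
      by (simp only: branch_fps_Suc_square) (simp add: algebra_simps)
    finally have "fps_expansion (branch (Suc k)) 0 = branch_fps (Suc k)"
      by (rule fps_square_eq_imp_eq [OF _ P0 branch_fps_nth_0])
    then show ?case
      using P [of "Suc k"] by simp
  qed
qed

section \<open>Lower bounds for the nested roots\<close>

text \<open>
  Since \<open>\<bar>1 - s\<bar> \<le> 1 / \<bar>1 + s\<bar>\<close> for \<open>s = branch k x\<close>, which stays in a sector around the
  positive reals, the radicand of the next square root is at least a constant times \<open>\<bar>s\<bar>\<close>.
\<close>

lemma norm_branch_Suc_ge:
  assumes x: "norm x < 1"
  shows "norm (branch k x) / 6 \<le> (norm (branch (Suc k) x))\<^sup>2"
proof -
  define s where "s = branch k x"
  have s: "\<bar>Im s\<bar> < Re s" "norm (1 - s) < 1" "norm (1 - s) * norm (1 + s) \<le> 1"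
    unfolding s_def using abs_Im_branch_less norm_one_minus_branch norm_one_minus_branch_mult x by auto
  have "Re s \<le> 2"
    using abs_Re_le_cmod [of "1 - s"] s(2) by simp
  have "1 + Re s \<le> norm (1 + s)"
    using complex_Re_le_cmod [of "1 + s"] by simp
  then have "norm (1 - s) * (1 + Re s) \<le> norm (1 - s) * norm (1 + s)"
    by (intro mult_left_mono) auto
  then have "norm (1 - s) * (1 + Re s) \<le> 1"
    using s(3) by linarith
  then have "norm (1 - s) \<le> 1 / (1 + Re s)"
    using s(1) by (simp add: field_simps)
  also have "\<dots> = 1 - Re s / (1 + Re s)"
    using s(1) by (simp add: field_simps)
  also have "\<dots> \<le> 1 - Re s / 3"
    using s(1) \<open>Re s \<le> 2\<close> by (intro diff_left_mono divide_left_mono) auto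
  finally have "Re s / 3 \<le> 1 - norm (1 - s)"
    by simp
  also have "\<dots> \<le> 1 - norm (x * (1 - s))"
    using x mult_left_le_one_le [of "norm (1 - s)" "norm x"] by (simp add: norm_mult)
  also have "\<dots> \<le> norm (1 - x * (1 - s))"
    using norm_triangle_ineq2 [of 1 "x * (1 - s)"] by simp
  also have "\<dots> = (norm (branch (Suc k) x))\<^sup>2"
    using branch_square(2) [OF x, of k] by (simp add: s_def power2_eq_square flip: norm_mult)
  finally have "Re s / 3 \<le> (norm (branch (Suc k) x))\<^sup>2" .
  \<comment> \<open>In the sector the modulus is at most twice the real part, which turns 1/3 into
    1/6.\<close>
  moreover have "norm s \<le> 2 * Re s"
    using cmod_le [of s] s(1) by linarith
  ultimately show ?thesis
    by (simp add: s_def)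
qed

text \<open>The function g_0 also vanishes at x = -1, so \<open>norm_branch_Suc_ge\<close> suffices
  only away from that point. For Re x < -1/4 the term 1 - x of the radicand (1 - x) + x g_0
  dominates instead.\<close>

lemma norm_branch_1_ge:
  assumes x: "norm x < 1"
  shows "sqrt (norm (1 - x)) / 12 \<le> (norm (branch 1 x))\<^sup>2"
proof -
  define a b where "a = sqrt (norm (1 - x))" and "b = sqrt (norm (1 + x))"
  have ab: "a \<ge> 0" "b \<ge> 0" "a\<^sup>2 = norm (1 - x)" "b\<^sup>2 = norm (1 + x)"
    by (auto simp: a_def b_def)
  have le: "a\<^sup>2 \<le> 2" "b\<^sup>2 \<le> 2"
    using x norm_triangle_ineq4 [of 1 x] norm_triangle_ineq [of 1 x] unfolding ab by auto
  have "branch 0 x * branch 0 x = (1 - x) * (1 + x)"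
    unfolding branch_square(1) [OF x] by (simp add: algebra_simps)
  then have "norm (branch 0 x) * norm (branch 0 x) = norm (1 - x) * norm (1 + x)"
    by (simp only: flip: norm_mult)
  then have "(norm (branch 0 x))\<^sup>2 = (a * b)\<^sup>2"
    by (simp add: power_mult_distrib ab) (simp add: power2_eq_square)
  then have g0: "norm (branch 0 x) = a * b"
    using ab by (simp add: power2_eq_iff_nonneg)
  show ?thesis
  proof (cases "Re x \<ge> - 1 / 4")
    case True
    then have "(1/2)\<^sup>2 \<le> b\<^sup>2"
      using complex_Re_le_cmod [of "1 + x"] unfolding ab by (simp add: power2_eq_square)
    then have "1/2 \<le> b"
      using ab(2) by (rule power2_le_imp_le)
    then have "a * (1/2) \<le> norm (branch 0 x)"
      unfolding g0 using ab by (intro mult_left_mono) auto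
    then show ?thesis
      using norm_branch_Suc_ge [OF x, of 0] by (simp add: a_def)
  next
    case False
    \<comment> \<open>In this half a^4 - b^4 exceeds 1. Factoring it and bounding a + b by 3 and a^2
      + b^2 by 4 yields a - b >= 1/12.\<close>
    have "(a\<^sup>2)\<^sup>2 - (b\<^sup>2)\<^sup>2 = - 4 * Re x"
      unfolding ab cmod_power2 by (simp add: power2_eq_square algebra_simps)
    then have ge: "1 \<le> (a - b) * ((a + b) * (a\<^sup>2 + b\<^sup>2))"
      using False by (simp add: power2_eq_square algebra_simps)
    have pos: "0 \<le> (a + b) * (a\<^sup>2 + b\<^sup>2)"
      using ab by simp
    have "a - b > 0"
      using ge pos by (metis mult_nonpos_nonneg not_less not_one_le_zero order_trans)
    have "a \<le> 3/2"
      by (rule power2_le_imp_le) (use le(1) in \<open>auto simp: power2_eq_square\<close>)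
    moreover have "b \<le> 3/2"
      by (rule power2_le_imp_le) (use le(2) in \<open>auto simp: power2_eq_square\<close>)
    ultimately have "(a + b) * (a\<^sup>2 + b\<^sup>2) \<le> 3 * 4"
      using le ab by (intro mult_mono) auto
    then have "(a - b) * ((a + b) * (a\<^sup>2 + b\<^sup>2)) \<le> (a - b) * (3 * 4)"
      using \<open>a - b > 0\<close> by (intro mult_left_mono) auto
    with ge have "1 \<le> (a - b) * (3 * 4)"
      by (rule order_trans)
    then have "1/12 \<le> a - b"
      by simp
    then have "a * (1/12) \<le> a * (a - b)"
      using ab by (intro mult_left_mono) auto
    also have "\<dots> = norm (1 - x) - norm (branch 0 x)"
      unfolding g0 ab(3) [symmetric] by (simp add: power2_eq_square algebra_simps)
    also have "\<dots> \<le> norm (1 - x) - norm (x * branch 0 x)"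
      using x mult_left_le_one_le [of "norm (branch 0 x)" "norm x"] by (simp add: norm_mult)
    also have "\<dots> \<le> norm ((1 - x) + x * branch 0 x)"
      by (rule norm_diff_ineq)
    also have "\<dots> = (norm (branch 1 x))\<^sup>2"
    proof -
      have "(1 - x) + x * branch 0 x = branch 1 x * branch 1 x"
        using branch_square(2) [OF x, of 0] by (simp add: algebra_simps)
      then show ?thesis
        by (simp only: norm_mult power2_eq_square)
    qed
    finally show ?thesis
      by (simp add: a_def)
  qed
qed

definition \<beta> :: "nat \<Rightarrow> real" where "\<beta> k = 1 / 2 ^ (k + 1)"

lemma \<beta>_Suc: "\<beta> k = 2 * \<beta> (Suc k)"
  by (simp add: \<beta>_def)

lemma \<beta>_pos: "0 < \<beta> k"
  by (simp add: \<beta>_def)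

lemma \<beta>_le: "\<beta> k \<le> 1/2"
  using one_le_power [of "2::real" k] by (simp add: \<beta>_def)

text \<open>Each root halves the exponent and turns c into sqrt(c/6). The induction starts at k = 1,
  since g_0 tends to 0 at x = -1 and admits no such bound.\<close>

lemma norm_branch_ge:
  assumes "k > 0"
  shows "\<exists>c>0. \<forall>x. norm x < 1 \<longrightarrow> c * norm (1 - x) powr \<beta> k \<le> norm (branch k x)"
  using assms
proof (induction k rule: nat_induct_non_zero)
  case 1
  have "sqrt (1/12) * norm (1 - x) powr \<beta> 1 \<le> norm (branch 1 x)" if x: "norm x < 1" for x
  proof (rule power2_le_imp_le)
    have "(norm (1 - x) powr \<beta> 1)\<^sup>2 = sqrt (norm (1 - x))"
      by (simp add: power2_eq_square \<beta>_def powr_half_sqrt flip: powr_add)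
    then show "(sqrt (1/12) * norm (1 - x) powr \<beta> 1)\<^sup>2 \<le> (norm (branch 1 x))\<^sup>2"
      using norm_branch_1_ge [OF x] by (simp add: power_mult_distrib)
  qed auto
  then show ?case
    by (intro exI [of _ "sqrt (1/12)"]) auto
next
  case (Suc k)
  then obtain c where c: "c > 0" "\<And>x. norm x < 1 \<Longrightarrow> c * norm (1 - x) powr \<beta> k \<le> norm (branch k x)"
    by blast
  have "sqrt (c/6) * norm (1 - x) powr \<beta> (Suc k) \<le> norm (branch (Suc k) x)" if x: "norm x < 1" for x
  proof (rule power2_le_imp_le)
    have "(norm (1 - x) powr \<beta> (Suc k))\<^sup>2 = norm (1 - x) powr \<beta> k"
      by (simp add: power2_eq_square \<beta>_Suc [of k] flip: powr_add)
    then have "(sqrt (c/6) * norm (1 - x) powr \<beta> (Suc k))\<^sup>2 = (c * norm (1 - x) powr \<beta> k) / 6"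
      using c(1) by (simp add: power_mult_distrib)
    also have "\<dots> \<le> norm (branch k x) / 6"
      using c(2) [OF x] by simp
    also have "\<dots> \<le> (norm (branch (Suc k) x))\<^sup>2"
      by (rule norm_branch_Suc_ge [OF x])
    finally show "(sqrt (c/6) * norm (1 - x) powr \<beta> (Suc k))\<^sup>2 \<le> (norm (branch (Suc k) x))\<^sup>2" .
  qed auto
  then show ?case
    using c(1) by (intro exI [of _ "sqrt (c/6)"]) auto
qed

section \<open>The factors h_k with the branch point at 1 divided out\<close>

definition reg_factor :: "nat \<Rightarrow> complex \<Rightarrow> complex" where
  "reg_factor k x = branch k x * (1 - x) powr of_real (- \<beta> k)"

lemma one_minus_ne_0: "1 - x \<noteq> 0" "1 - x \<notin> \<real>\<^sub>\<le>\<^sub>0" if "norm (x::complex) < 1"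
  using csqrt_one_minus(1) [OF that] by auto

lemma branch_eq: "branch k x = (1 - x) powr of_real (\<beta> k) * reg_factor k x" if "norm x < 1"
  using one_minus_ne_0 [OF that] by (simp add: reg_factor_def powr_minus field_simps)

lemma reg_factor_field_differentiable: "reg_factor k field_differentiable (at x)" if "norm x < 1"
proof -
  have "((\<lambda>x. (1 - x) powr of_real (- \<beta> k)) has_field_derivative
      - (of_real (- \<beta> k) * (1 - x) powr (of_real (- \<beta> k) - 1))) (at x)"
    using one_minus_ne_0 [OF that]
    by (auto intro!: derivative_eq_intros DERIV_chain' [OF _ has_field_derivative_powr, of "\<lambda>x. 1 - x"])
  then have "(\<lambda>x. (1 - x) powr of_real (- \<beta> k)) field_differentiable (at x)"
    unfolding field_differentiable_def by blast
  then show ?thesis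
    unfolding reg_factor_def [abs_def] using branch_field_differentiable [OF that]
    by (intro field_differentiable_mult)
qed

text \<open>Principal roots multiply here: those of 1 - x and 1 + x have arguments below pi/4 in
  modulus, so their product has positive real part and is the principal root of 1 - x^2.\<close>

lemma reg_factor_0: "reg_factor 0 x = (1 + x) powr of_real (1/2)" if x: "norm x < 1"
proof -
  define s t where "s = csqrt (1 - x)" and "t = csqrt (1 - (- x))"
  have st: "s * s = 1 - x" "t * t = 1 + x" "\<bar>Im s\<bar> < Re s" "\<bar>Im t\<bar> < Re t"
    using csqrt_one_minus(2,3) [of x] csqrt_one_minus(2,3) [of "- x"] x by (auto simp: s_def t_def)
  have "\<bar>Im s\<bar> * \<bar>Im t\<bar> < Re s * Re t"
    using st by (intro mult_strict_mono') auto
  then have "0 < Re (s * t)"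
    using abs_ge_self [of "Im s * Im t"] by (simp add: abs_mult)
  moreover have "(s * t)\<^sup>2 = 1 - x * x"
  proof -
    have "(s * t)\<^sup>2 = (s * s) * (t * t)"
      by (simp add: power2_eq_square)
    then show ?thesis
      unfolding st by (simp add: algebra_simps)
  qed
  ultimately have "branch 0 x = s * t"
    using csqrt_square [of "s * t"] by (simp add: branch.simps)
  moreover have "s = (1 - x) powr of_real (1/2)" "t = (1 + x) powr of_real (1/2)"
    unfolding s_def t_def using one_minus_ne_0(1) [OF x] one_minus_ne_0(1) [of "-x"] x
    by (simp_all add: csqrt_conv_powr)
  ultimately show ?thesis
    using one_minus_ne_0 [OF x] by (simp add: reg_factor_def \<beta>_def powr_minus)
qed

text \<open>Squaring doubles the exponent, and 2 \<beta>_(k+1) = \<beta>_k. The form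
  \<open>1 + -1 * x\<close> matches \<open>tame_powr\<close> with e = -1.\<close>

lemma reg_factor_Suc_square:
  assumes x: "norm x < 1"
  shows "reg_factor (Suc k) x * reg_factor (Suc k) x = (1 + -1 * x) powr of_real (1 - \<beta> k) + x * reg_factor k x"
proof -
  have "reg_factor (Suc k) x * reg_factor (Suc k) x =
      branch (Suc k) x * branch (Suc k) x * ((1 - x) powr of_real (- \<beta> (Suc k)) * (1 - x) powr of_real (- \<beta> (Suc k)))"
    by (simp only: reg_factor_def mult_ac)
  also have "(1 - x) powr of_real (- \<beta> (Suc k)) * (1 - x) powr of_real (- \<beta> (Suc k)) = (1 - x) powr of_real (- \<beta> k)"
    by (simp add: \<beta>_Suc [of k] flip: powr_add)
  also have "branch (Suc k) x * branch (Suc k) x = (1 - x) + x * branch k x"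
    using branch_square(2) [OF x, of k] by (simp add: algebra_simps)
  also have "((1 - x) + x * branch k x) * (1 - x) powr of_real (- \<beta> k) =
      (1 - x) * (1 - x) powr of_real (- \<beta> k) + x * reg_factor k x"
    by (simp add: reg_factor_def algebra_simps)
  also have "(1 - x) * (1 - x) powr of_real (- \<beta> k) = (1 - x) powr of_real (1 - \<beta> k)"
    using powr_add [of "1 - x" 1 "of_real (- \<beta> k)"] one_minus_ne_0 [OF x] by simp
  finally show ?thesis
    by simp
qed

text \<open>The radicand of each step is tame by induction, and \<open>norm_branch_ge\<close> at k +
  1 says that h_(k+1) is bounded away from 0, so \<open>tame_sqrt\<close> applies. The seed h_0 is
  tame directly, although it tends to 0 at x = -1.\<close>

lemma tame_reg_factor: "\<exists>h' h'' C. tame (reg_factor k) h' h'' C"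
proof (induction k)
  case 0
  obtain f' f'' C where C: "tame (\<lambda>x. (1 + 1 * x) powr of_real (1/2)) f' f'' C"
    using tame_powr [of 1 "1/2"] by auto
  have "tame (reg_factor 0) f' f'' C"
    unfolding tame_def
  proof (intro conjI allI impI)
    fix x :: complex assume x: "norm x < 1"
    show "(reg_factor 0 has_field_derivative f' x) (at x)"
      by (rule has_field_derivative_transform_within_open [OF tameD(2) [OF C x], of "ball 0 1"])
        (use x reg_factor_0 in auto)
  qed (use tameD [OF C] reg_factor_0 in auto)
  then show ?case
    by blast
next
  case (Suc k)
  then obtain h' h'' C where C: "tame (reg_factor k) h' h'' C"
    by blast
  obtain f' f'' D where D: "tame (\<lambda>x. (1 + -1 * x) powr of_real (1 - \<beta> k)) f' f'' D"
    using tame_powr [of "-1" "1 - \<beta> k"] \<beta>_le [of k] \<beta>_pos [of k] by auto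
  obtain c where c: "c > 0" "\<And>x. norm x < 1 \<Longrightarrow> c * norm (1 - x) powr \<beta> (Suc k) \<le> norm (branch (Suc k) x)"
    using norm_branch_ge [of "Suc k"] by blast
  have "c \<le> norm (reg_factor (Suc k) x)" if x: "norm x < 1" for x
  proof -
    have "c = c * norm (1 - x) powr \<beta> (Suc k) * norm (1 - x) powr (- \<beta> (Suc k))"
      using one_minus_ne_0 [OF x] by (simp add: powr_minus)
    also have "\<dots> \<le> norm (branch (Suc k) x) * norm (1 - x) powr (- \<beta> (Suc k))"
      using c(2) [OF x] by (intro mult_right_mono) auto
    also have "\<dots> = norm (reg_factor (Suc k) x)"
      using one_minus_ne_0 [OF x] by (simp only: reg_factor_def norm_mult norm_powr_real_powr' Reals_of_real Re_complex_of_real)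
    finally show ?thesis .
  qed
  then show ?case
    using tame_sqrt [OF tame_add [OF D tame_ident_mult [OF C]] reg_factor_field_differentiable
        reg_factor_Suc_square _ c(1)] by blast
qed

lemma Re_reg_factor_pos:
  assumes "0 < r" "r < 1"
  shows "0 < Re (reg_factor k (of_real r))"
proof -
  have "(1 - of_real r :: complex) powr of_real (- \<beta> k) = of_real ((1 - r) powr (- \<beta> k))"
    using powr_of_real [of "1 - r" "- \<beta> k"] assms by simp
  then have "reg_factor k (of_real r) = branch k (of_real r) * of_real ((1 - r) powr (- \<beta> k))"
    by (simp only: reg_factor_def)
  then show ?thesis
    using abs_Im_branch_less [of "of_real r" k] assms by simp
qed

text \<open>As r tends to 1 the term (1 - r)^(1 - \<beta>_k) vanishes, so the limit of h_(k+1) is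
  the square root of that of h_k, starting from sqrt 2.\<close>

lemma reg_factor_tendsto: "((\<lambda>r. reg_factor k (of_real r)) \<longlongrightarrow> of_real (2 powr \<beta> k)) (at_left 1)"
proof (induction k)
  have ev: "\<forall>\<^sub>F r in at_left 1. 0 < r \<and> r < (1::real)"
    using eventually_at_left_real [of 0 "1::real"] by simp
  case 0
  have "((\<lambda>r. of_real ((1 + r) powr (1/2)) :: complex) \<longlongrightarrow> of_real (2 powr (1/2))) (at_left 1)"
    by (auto intro!: tendsto_eq_intros)
  moreover have "\<forall>\<^sub>F r in at_left 1. of_real ((1 + r) powr (1/2)) = reg_factor 0 (of_real r)"
    using ev
  proof eventually_elim
    case (elim r)
    then show ?case
      using powr_of_real [of "1 + r" "1/2"] by (simp add: reg_factor_0)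
  qed
  ultimately show ?case
    unfolding \<beta>_def by (simp add: Lim_transform_eventually)
next
  have ev: "\<forall>\<^sub>F r in at_left 1. 0 < r \<and> r < (1::real)"
    using eventually_at_left_real [of 0 "1::real"] by simp
  case (Suc k)
  have "((\<lambda>r. (1 - r) powr (1 - \<beta> k)) \<longlongrightarrow> 0) (at_left 1)"
  proof -
    have "((\<lambda>r. (1 - r) powr (1 - \<beta> k)) \<longlongrightarrow> (1 - 1) powr (1 - \<beta> k)) (at_left 1)"
      by (rule tendsto_powr2)
        (use \<beta>_le [of k] ev in \<open>auto intro!: tendsto_eq_intros elim: eventually_mono\<close>)
    then show ?thesis by simp
  qed
  then have "((\<lambda>r. csqrt (of_real ((1 - r) powr (1 - \<beta> k)) + of_real r * reg_factor k (of_real r))) \<longlongrightarrow>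
      csqrt (of_real 0 + of_real 1 * of_real (2 powr \<beta> k))) (at_left 1)"
    by (intro isCont_tendsto_compose [OF continuous_at_csqrt] tendsto_intros Suc) (auto simp: complex_nonpos_Reals_iff)
  also have "csqrt (of_real 0 + of_real 1 * of_real (2 powr \<beta> k)) = of_real (2 powr \<beta> (Suc k))"
  proof -
    have "sqrt (2 powr \<beta> k) = 2 powr \<beta> (Suc k)"
      by (simp add: \<beta>_Suc [of k] flip: powr_half_sqrt) (simp add: powr_powr)
    then show ?thesis
      using of_real_sqrt [of "2 powr \<beta> k"] by simp
  qed
  finally show ?case
  proof (rule Lim_transform_eventually)
    show "\<forall>\<^sub>F r in at_left 1. csqrt (of_real ((1 - r) powr (1 - \<beta> k)) + of_real r * reg_factor k (of_real r)) =
        reg_factor (Suc k) (of_real r)"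
      using ev
    proof eventually_elim
      case (elim r)
      then have "of_real ((1 - r) powr (1 - \<beta> k)) + of_real r * reg_factor k (of_real r) = (reg_factor (Suc k) (of_real r))\<^sup>2"
        using reg_factor_Suc_square [of "of_real r" k] powr_of_real [of "1 - r" "1 - \<beta> k"]
        by (simp add: power2_eq_square)
      \<comment> \<open>The positive real part of h_(k+1) on the radius identifies it with the
        principal root of its square.\<close>
      then show ?case
        using csqrt_square [of "reg_factor (Suc k) (of_real r)"] Re_reg_factor_pos [of r "Suc k"] elim
        by simp
    qed
  qed
qed

section \<open>From the radial limit at 1 to the coefficients\<close>

lemma suminf_eq_radial_limit:
  fixes F :: "complex fps"
  assumes F: "f has_fps_expansion F" and hol: "f holomorphic_on ball 0 1"
    and summable: "summable (\<lambda>n. norm (fps_nth F n))"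
    and lim: "((\<lambda>r. f (of_real r)) \<longlongrightarrow> L) (at_left 1)"
  shows "(\<Sum>n. fps_nth F n) = L"
proof -
  have ev: "\<forall>\<^sub>F r in at_left 1. 0 < r \<and> r < (1::real)"
    using eventually_at_left_real [of 0 "1::real"] by simp
  have "((\<lambda>r::real. \<Sum>n. fps_nth F n * of_real r ^ n) \<longlongrightarrow> (\<Sum>n. fps_nth F n)) (at_left 1)"
  proof (rule conjunct2 [OF conjunct2 [OF tannerys_theorem]])
    show "((\<lambda>r::real. fps_nth F n * of_real r ^ n) \<longlongrightarrow> fps_nth F n) (at_left 1)" for n
      by (auto intro!: tendsto_eq_intros)
    show "\<forall>\<^sub>F (n, r) in at_top \<times>\<^sub>F at_left (1::real). norm (fps_nth F n * of_real r ^ n) \<le> norm (fps_nth F n)"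
      unfolding eventually_prod_filter
    proof (intro exI conjI allI impI)
      show "\<forall>\<^sub>F n in at_top. True"
        by simp
      show "\<forall>\<^sub>F r in at_left 1. 0 < r \<and> r < (1::real)"
        by (rule ev)
    qed (auto simp: norm_mult norm_power mult_left_le power_le_one)
  qed (use summable in auto)
  moreover have "\<forall>\<^sub>F r in at_left 1. (\<Sum>n. fps_nth F n * of_real r ^ n) = f (of_real r)"
    using ev
  proof eventually_elim
    case (elim r)
    show ?case
      using has_fps_expansion_imp_eval_fps_eq [OF F _ hol, of "of_real r"] elim
      by (simp add: eval_fps_def)
  qed
  ultimately have "((\<lambda>r::real. f (of_real r)) \<longlongrightarrow> (\<Sum>n. fps_nth F n)) (at_left 1)"
    by (rule Lim_transform_eventually)
  then show ?thesis
    using tendsto_unique [OF _ _ lim] by simp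
qed

lemma complex_of_real_gbinomial: "(of_real a gchoose n :: complex) = of_real (a gchoose n)"
  by (simp add: gbinomial_prod_rev)

lemma one_minus_powr_has_fps_expansion:
  "(\<lambda>x. (1 - x) powr of_real a) has_fps_expansion
    Abs_fps (\<lambda>n. complex_of_real ((-1) ^ n * (a gchoose n)))"
proof -
  have "((\<lambda>x::complex. (1 + x) powr of_real a) \<circ> (\<lambda>x. -1 * x)) has_fps_expansion
      fps_compose (fps_binomial (of_real a)) (fps_const (-1) * fps_X)"
    by (intro has_fps_expansion_compose fps_expansion_intros) auto
  moreover have "fps_compose (fps_binomial (of_real a)) (fps_const (-1) * fps_X) =
      Abs_fps (\<lambda>n. complex_of_real ((-1) ^ n * (a gchoose n)))"
    unfolding fps_compose_linear by (simp add: complex_of_real_gbinomial)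
  ultimately show ?thesis
    by (simp add: o_def)
qed

text \<open>This is \<open>gbinomial_asymptotic\<close> with exp((a + 1) ln n) rewritten as a power
  of n.\<close>

lemma gbinomial_powr_tendsto:
  "(\<lambda>n. real n powr (1 + a) * ((-1) ^ n * (a gchoose n))) \<longlonglongrightarrow> inverse (Gamma (- a))"
proof (rule Lim_transform_eventually [OF gbinomial_asymptotic [of a]])
  show "\<forall>\<^sub>F n in sequentially. (a gchoose n) / ((- 1) ^ n / exp ((a + 1) * of_real (ln (real n)))) =
      real n powr (1 + a) * ((-1) ^ n * (a gchoose n))"
    using eventually_gt_at_top [of 0]
  proof eventually_elim
    case (elim n)
    then have "exp ((a + 1) * of_real (ln (real n))) = real n powr (1 + a)"
      by (simp add: powr_def add.commute)
    moreover have "((-1) ^ n :: real) * (-1) ^ n = 1"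
      by (simp flip: power_mult_distrib)
    ultimately show ?case
      by (simp add: divide_simps mult_ac)
  qed
qed

lemma branch_fps_nth_tendsto:
  assumes "k > 0"
  shows "(\<lambda>n. real n powr (1 + \<beta> k) * Re (branch_fps k $ n)) \<longlonglongrightarrow> 2 powr \<beta> k * inverse (Gamma (- \<beta> k))"
proof -
  obtain h' h'' C where C: "tame (reg_factor k) h' h'' C"
    using tame_reg_factor by blast
  have hol: "reg_factor k holomorphic_on ball 0 1"
    using reg_factor_field_differentiable by (auto simp: holomorphic_on_def intro: field_differentiable_at_within)
  define H where "H = fps_expansion (reg_factor k) 0"
  have H: "reg_factor k has_fps_expansion H"
    unfolding H_def using hol by (intro has_fps_expansion_fps_expansion [of "ball 0 1"]) auto
  obtain K where K: "\<And>n. n > 0 \<Longrightarrow> norm (H $ n) \<le> K * real n powr (-3/2)"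
    using fps_nth_bound_of_second_derivative [OF H tameD(2) [OF C] tameD(3) [OF C] tameD(6) [OF C]] by blast
  have summable: "summable (\<lambda>n. norm (H $ n))"
    by (rule summable_comparison_test' [where N = 1, OF summable_mult [of "\<lambda>n. real n powr (-3/2)" K]])
      (use K in \<open>auto simp: summable_real_powr_iff\<close>)
  have "(\<Sum>n. H $ n) = of_real (2 powr \<beta> k)"
    by (rule suminf_eq_radial_limit [OF H hol summable reg_factor_tendsto])
  then have sum: "(\<Sum>n. Re (H $ n)) = 2 powr \<beta> k"
    using Re_suminf [OF summable_norm_cancel [OF summable]] by simp
  define a where "a n = (-1) ^ n * (\<beta> k gchoose n)" for n
  have "(\<lambda>x. (1 - x) powr of_real (\<beta> k) * reg_factor k x) has_fps_expansion Abs_fps (\<lambda>n. complex_of_real (a n)) * H"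
    unfolding a_def by (intro has_fps_expansion_mult one_minus_powr_has_fps_expansion H)
  moreover have "\<forall>\<^sub>F x in nhds 0. branch k x = (1 - x) powr of_real (\<beta> k) * reg_factor k x"
    using eventually_nhds_in_open [of "ball 0 1" "0::complex"] by (auto elim!: eventually_mono intro!: branch_eq)
  ultimately have "branch k has_fps_expansion Abs_fps (\<lambda>n. complex_of_real (a n)) * H"
    by (subst has_fps_expansion_cong) auto
  then have "branch_fps k = H * Abs_fps (\<lambda>n. complex_of_real (a n))"
    using fps_expansion_unique_complex [OF branch_has_fps_expansion] by (simp add: mult.commute)
  then have Re_nth: "Re (branch_fps k $ n) = (\<Sum>j\<le>n. Re (H $ j) * a (n - j))" for n
    by (simp add: fps_mult_nth atLeast0AtMost)
  \<comment> \<open>Strictness keeps p = 1 + \<beta>_k below q = 3/2 in the convolution lemma; k = 0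
    would give equality.\<close>
  have "\<beta> k < 1/2"
    using \<beta>_Suc [of "k - 1"] \<beta>_le [of "k - 1"] assms by simp
  then have "(\<lambda>n. real n powr (1 + \<beta> k) * (\<Sum>j\<le>n. Re (H $ j) * a (n - j))) \<longlonglongrightarrow>
      (\<Sum>n. Re (H $ n)) * inverse (Gamma (- \<beta> k))"
    using \<beta>_pos [of k] K
    by (intro convolution_tendsto [where q = "3/2" and C = K])
      (auto simp: a_def gbinomial_powr_tendsto intro: order_trans [OF abs_Re_le_cmod])
  then show ?thesis
    by (simp add: Re_nth sum)
qed

theorem proposition2:
  fixes k :: nat and \<alpha> :: real
  assumes "k \<ge> 1"
    and "\<alpha> = 1 / 2 ^ (k + 1)"
  shows "(\<lambda>n. fps_nth (B k) n) \<sim>[at_top]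
    (\<lambda>n. - (2 powr (real n + \<alpha>) * (real n powr (- 1 - \<alpha>) / Gamma (- \<alpha>))))"
proof (rule asymp_equivI')
  have \<alpha>: "\<alpha> = \<beta> k"
    using assms(2) by (simp add: \<beta>_def)
  have "0 < \<alpha>" "\<alpha> < 1"
    using \<beta>_pos [of k] \<beta>_le [of k] by (auto simp: \<alpha>)
  \<comment> \<open>\<open>Gamma\<close> takes the value 0 at its poles, so -\<alpha>, which lies
    strictly between -1 and 0, must be kept apart from them before dividing.\<close>
  then have "- \<alpha> \<notin> \<int>\<^sub>\<le>\<^sub>0"
    by (auto elim!: nonpos_Ints_cases')
  then have Gamma: "Gamma (- \<alpha>) \<noteq> 0"
    by (simp add: Gamma_eq_zero_iff)
  have lim_Suc: "(\<lambda>n. real (Suc n) powr (1 + \<alpha>) * Re (branch_fps k $ Suc n)) \<longlonglongrightarrow> 2 powr \<alpha> * inverse (Gamma (- \<alpha>))"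
    using LIMSEQ_Suc [OF branch_fps_nth_tendsto [of k]] assms(1) by (simp add: \<alpha>)
  \<comment> \<open>Coefficient n of \<open>B k\<close> sits at index n + 1 of
    \<open>branch_fps k\<close>; this ratio moves the power from n + 1 back to n.\<close>
  have "(\<lambda>n. (real n / real (Suc n)) powr (1 + \<alpha>)) \<longlonglongrightarrow> 1 powr (1 + \<alpha>)"
    by (intro tendsto_powr LIMSEQ_n_over_Suc_n tendsto_const) auto
  then have "(\<lambda>n. (real n / real (Suc n)) powr (1 + \<alpha>) * (real (Suc n) powr (1 + \<alpha>) * Re (branch_fps k $ Suc n)) *
      - (Gamma (- \<alpha>) / 2 powr \<alpha>)) \<longlonglongrightarrow>
      1 powr (1 + \<alpha>) * (2 powr \<alpha> * inverse (Gamma (- \<alpha>))) * - (Gamma (- \<alpha>) / 2 powr \<alpha>)"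
    by (intro tendsto_mult [OF tendsto_mult [OF _ lim_Suc]] tendsto_const)
  also have "1 powr (1 + \<alpha>) * (2 powr \<alpha> * inverse (Gamma (- \<alpha>))) * - (Gamma (- \<alpha>) / 2 powr \<alpha>) = -1"
    using Gamma by simp
  finally have lim: "(\<lambda>n. - ((real n / real (Suc n)) powr (1 + \<alpha>) *
      (real (Suc n) powr (1 + \<alpha>) * Re (branch_fps k $ Suc n)) * - (Gamma (- \<alpha>) / 2 powr \<alpha>))) \<longlonglongrightarrow> 1"
    using tendsto_minus by fastforce
  show "((\<lambda>n. B k $ n / - (2 powr (real n + \<alpha>) * (real n powr (- 1 - \<alpha>) / Gamma (- \<alpha>)))) \<longlongrightarrow> 1) at_top"
  proof (rule Lim_transform_eventually [OF lim])
    show "\<forall>\<^sub>F n in sequentially. - ((real n / real (Suc n)) powr (1 + \<alpha>) *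
        (real (Suc n) powr (1 + \<alpha>) * Re (branch_fps k $ Suc n)) * - (Gamma (- \<alpha>) / 2 powr \<alpha>)) =
        B k $ n / - (2 powr (real n + \<alpha>) * (real n powr (- 1 - \<alpha>) / Gamma (- \<alpha>)))"
      using eventually_gt_at_top [of 0]
    proof eventually_elim
      case (elim n)
      have "(real n / real (Suc n)) powr (1 + \<alpha>) * real (Suc n) powr (1 + \<alpha>) = real n powr (1 + \<alpha>)"
        by (simp flip: powr_mult)
      moreover have "real n powr (- 1 - \<alpha>) = inverse (real n powr (1 + \<alpha>))"
        by (simp flip: powr_minus)
      moreover have "2 powr (real n + \<alpha>) = 2 ^ n * 2 powr \<alpha>"
        by (simp add: powr_add powr_realpow)
      moreover have "Re (branch_fps k $ Suc n) = - (B k $ n / 2 ^ n)"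
        by (simp add: branch_fps_nth_Suc)
      ultimately show ?case
        using elim Gamma by (simp add: field_simps)
    qed
  qed
qed

end
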